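(* Every (finite) tree and every cycle graph $C_n$ ($n\ge 3$) is realizable as a Bell coloring graph; that is, for each such graph $H$ there exist a finite simple graph $G$ and a positive integer $k$ with $\mathcal{B}_k(G)\cong H$.
   Context: All graphs are finite and simple. A stable $k$-partition of a graph $G$ is a multiset $P=\{V_1,\dots,V_k\}$ of $k$ independent sets of $G$ (some possibly empty) that partition $V(G)$. For $v\in V(G)$, $P-v$ denotes the multiset $\{V_i\setminus\{v\}:1\le i\le k\}$. The Bell $k$-coloring graph $\mathcal{B}_k(G)$ has as vertices all stable $k$-partitions of $G$, and two distinct partitions $P,Q$ are adjacent if and only if $P-v=Q-v$ for some $v\in V(G)$. *)

theory Defs
  imports
    "Graph_Theory.Pair_Digraph"
    "Graph_Theory.Digraph_Component"
    "Graph_Theory.Digraph_Isomorphism"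
    "HOL-Library.Multiset"
    "HOL-Library.Disjoint_Sets"
begin

text \<open>
  A finite simple graph is a \<^locale>\<open>pair_graph\<close>: an undirected edge $uv$ is the pair of
  opposite arcs $(u,v)$, $(v,u)$. For such graphs \<^const>\<open>digraph_iso\<close> is graph isomorphism.
\<close>

text \<open>
  The library's \<^const>\<open>forest\<close> and \<^const>\<open>tree\<close> cannot be used here: in a symmetric
  digraph \<^const>\<open>pre_digraph.cycle\<close> also holds of the closed walk $u,v,u$ along a single edge.
  The cycles of the undirected graph are those of length at least 3. Note that
  \<^const>\<open>connected\<close> includes nonemptiness of the vertex set.
\<close>

definition is_tree :: "'a pair_pre_digraph \<Rightarrow> bool" where
  "is_tree T \<longleftrightarrow> pair_graph T \<and> connected (with_proj T) \<and>
     \<not> (\<exists>p. pre_digraph.cycle (with_proj T) p \<and> 3 \<le> length p)"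

definition cycle_graph :: "nat \<Rightarrow> nat pair_pre_digraph" where
  "cycle_graph n =
     \<lparr>pverts = {..<n},
      parcs = {(i, j). i < n \<and> j < n \<and> (j = Suc i mod n \<or> i = Suc j mod n)}\<rparr>"

definition independent_set :: "'a pair_pre_digraph \<Rightarrow> 'a set \<Rightarrow> bool" where
  "independent_set G A \<longleftrightarrow> A \<subseteq> pverts G \<and> (\<forall>u\<in>A. \<forall>v\<in>A. (u, v) \<notin> parcs G)"

text \<open>
  The classes form a multiset because the empty class may occur several times.
\<close>

definition stable_partitions :: "nat \<Rightarrow> 'a pair_pre_digraph \<Rightarrow> 'a set multiset set" where
  "stable_partitions k G =
     {image_mset V (mset_set {1..k}) | V.
        (\<forall>i\<in>{1..k}. independent_set G (V i)) \<and>
        disjoint_family_on V {1..k} \<and> (\<Union>i\<in>{1..k}. V i) = pverts G}"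

definition remove_vertex :: "'a \<Rightarrow> 'a set multiset \<Rightarrow> 'a set multiset" where
  "remove_vertex v P = image_mset (\<lambda>A. A - {v}) P"

definition bell_graph :: "nat \<Rightarrow> 'a pair_pre_digraph \<Rightarrow> 'a set multiset pair_pre_digraph" where
  "bell_graph k G =
     \<lparr>pverts = stable_partitions k G,
      parcs = {(P, Q). P \<in> stable_partitions k G \<and> Q \<in> stable_partitions k G \<and> P \<noteq> Q \<and>
                 (\<exists>v\<in>pverts G. remove_vertex v P = remove_vertex v Q)}\<rparr>"

text \<open>
  Taking the vertices of the witness to be natural numbers loses no generality, since every finite
  graph is isomorphic to such a graph.
\<close>

definition bell_realizable :: "'a pair_pre_digraph \<Rightarrow> bool" where
  "bell_realizable H \<longleftrightarrow>
     (\<exists>(G :: nat pair_pre_digraph) k. pair_graph G \<and> 0 < k \<and>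
        digraph_iso (with_proj (bell_graph k G)) (with_proj H))"

end

theory Submission
  imports Defs
begin

text \<open>
  If \<open>G\<close> is the complement of a triangle-free graph with edge set \<open>E\<close>, the nonempty classes of a
  stable partition are single vertices and edges forming a matching, so for \<open>k = |V| - s\<close> the stable
  \<open>k\<close>-partitions are the matchings with at least \<open>s\<close> edges, and adjacent partitions differ by changing
  the edge at one vertex.

  For a tree \<open>T\<close> take the subdivision of \<open>T\<close>: its matchings that cover all subdivision vertices miss
  exactly one vertex of \<open>T\<close>, which determines the matching, and sliding an edge moves the missed vertex
  along an edge of \<open>T\<close>. An odd cycle of length at least 5 is realized in the same way by the matchings
  of the cycle itself that miss one vertex. For an even cycle of length at least 6 take two vertices
  joined by three paths of even length, two of them of length 2; the star with three leaves and two
  disjoint edges give the cycles of length 3 and 4.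
\<close>

text \<open>Trees and even cycles of length at least 6 come from bipartite graphs with one side
  \<open>B\<close> a single vertex smaller than the other. When every element of \<open>B\<close>
  has to be matched, a matching is an injective choice function on \<open>B\<close>, and adjacency
  means changing one value. An odd cycle is not bipartite, so its matchings are treated directly;
  hence the separate layer between partitions and choice functions. The three paths arise from the
  tree case: in the subdivision of a path with r + 2 vertices, the two end vertices are given the
  same neighbours. Exchanging these twins produces a second copy of the path of matchings, and the
  copies are adjacent exactly at corresponding ends, which closes a cycle of length 2 (r + 2). For r
  = 0 only two choices remain, and a cycle of length 3 is itself a triangle, so lengths 4 and 3 need
  graphs of their own.\<close>

lemma digraph_iso_with_projI:
  assumes G: "parcs G \<subseteq> pverts G \<times> pverts G" and H: "parcs H \<subseteq> pverts H \<times> pverts H"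
    and f: "bij_betw f (pverts H) (pverts G)"
    and arcs: "\<And>x y. x \<in> pverts H \<Longrightarrow> y \<in> pverts H \<Longrightarrow>
                 (x, y) \<in> parcs H \<longleftrightarrow> (f x, f y) \<in> parcs G"
  shows "digraph_iso (with_proj G) (with_proj H)"
proof -
  \<comment> \<open>Matchings are parametrised by the vertices of \<open>H\<close>, so
    \<open>f\<close> starts there; the isomorphism to be produced starts at the Bell graph, whence
    the inverse.\<close>
  define g where "g = the_inv_into (pverts H) f"
  have g: "bij_betw g (pverts G) (pverts H)"
    unfolding g_def by (rule bij_betw_the_inv_into[OF f])
  have gf: "g (f x) = x" if "x \<in> pverts H" for x
    using f that by (simp add: g_def bij_betw_def the_inv_into_f_f)
  have fg: "f (g x) = x" if "x \<in> pverts G" for x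
    using f that by (simp add: g_def f_the_inv_into_f_bij_betw)
  define h where
    "h = \<lparr>iso_verts = g, iso_arcs = map_prod g g, iso_head = snd, iso_tail = fst\<rparr>"
  have "wf_digraph (with_proj G)"
    using G by unfold_locales auto
  moreover have "inj_on g (pverts G)"
    using g by (simp add: bij_betw_def)
  moreover from this have "inj_on (map_prod g g) (parcs G)"
    using map_prod_inj_on inj_on_subset G by metis
  ultimately have "pre_digraph.digraph_isomorphism (with_proj G) h"
    by (auto simp: pre_digraph.digraph_isomorphism_def h_def)
  moreover have "map_prod g g ` parcs G = parcs H"
  proof (intro equalityI subsetI)
    fix a assume "a \<in> map_prod g g ` parcs G"
    then obtain x y where a: "a = (g x, g y)" and xy: "(x, y) \<in> parcs G" by auto
    with G have "x \<in> pverts G" "y \<in> pverts G" by auto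
    with g have "g x \<in> pverts H" "g y \<in> pverts H" by (auto simp: bij_betw_def)
    with arcs xy fg \<open>x \<in> _\<close> \<open>y \<in> _\<close> show "a \<in> parcs H" by (simp add: a)
  next
    fix a assume a: "a \<in> parcs H"
    then obtain x y where [simp]: "a = (x, y)" by (cases a)
    from a H have xy: "x \<in> pverts H" "y \<in> pverts H" by auto
    with a arcs have "(f x, f y) \<in> parcs G" by simp
    then show "a \<in> map_prod g g ` parcs G"
      using gf xy by (intro image_eqI[where x = "(f x, f y)"]) auto
  qed
  moreover have "g ` pverts G = pverts H"
    using g by (simp add: bij_betw_def)
  ultimately show ?thesis
    unfolding digraph_iso_def by (intro exI[of _ h]) (auto simp: h_def app_iso_def with_proj_def)
qed

section \<open>Stable partitions and matchings of the complement\<close>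

text \<open>A stable partition is encoded by its set of nonempty classes: only the empty class can
  repeat, so \<open>k\<close> restores the multiset. For finite \<open>C\<close> with
  \<open>card C \<le> k\<close> the result has exactly \<open>k\<close> members.\<close>

definition pad :: "nat \<Rightarrow> 'a set set \<Rightarrow> 'a set multiset" where
  "pad k C = mset_set C + replicate_mset (k - card C) {}"

lemma pad_inject:
  assumes "finite C" "finite D" "{} \<notin> C" "{} \<notin> D" "pad k C = pad k D"
  shows "C = D"
proof -
  have "set_mset (pad k X) - {{}} = X" if "finite X" "{} \<notin> X" for X :: "'a set set"
    using that by (auto simp: pad_def)
  from this[of C] this[of D] show ?thesis using assms by metis
qed

text \<open>A value taken at two indices is disjoint from itself, hence empty; so \<open>V\<close>
  is injective where it is nonempty. This serves both the labelled families of the definition and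
  the classes left after deleting a vertex.\<close>

lemma image_mset_disjoint_family:
  assumes "finite I" "disjoint_family_on V I"
  shows "image_mset V (mset_set I) = pad (card I) (V ` I - {{}})"
    and "card (V ` I - {{}}) \<le> card I"
proof -
  define J where "J = {i \<in> I. V i \<noteq> {}}"
  have fin: "finite J" and JI: "J \<subseteq> I" using assms by (auto simp: J_def)
  have inj: "inj_on V J"
    using assms(2) by (fastforce simp: inj_on_def J_def disjoint_family_on_def)
  have img: "V ` I - {{}} = V ` J" by (auto simp: J_def)
  have "mset_set I = mset_set J + mset_set (I - J)"
    using JI assms(1) fin by (metis Diff_partition mset_set_Union finite_Diff Diff_disjoint)
  moreover have "image_mset V (mset_set J) = mset_set (V ` J)"
    using inj by (rule image_mset_mset_set)
  moreover have "image_mset V (mset_set (I - J)) = image_mset (\<lambda>_. {}) (mset_set (I - J))"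
    using assms(1) by (intro image_mset_cong) (auto simp: J_def)
  ultimately show "image_mset V (mset_set I) = pad (card I) (V ` I - {{}})"
    using fin JI inj assms(1)
    by (simp add: pad_def img image_mset_const_eq card_Diff_subset card_image)
  show "card (V ` I - {{}}) \<le> card I"
    using fin JI assms(1) unfolding img by (meson card_image_le card_mono le_trans)
qed

lemma stable_partitions_eq_pad:
  assumes "finite (pverts G)"
  shows "stable_partitions k G =
    pad k ` {C. partition_on (pverts G) C \<and> (\<forall>A\<in>C. independent_set G A) \<and> card C \<le> k}"
proof (intro equalityI subsetI)
  fix P assume "P \<in> stable_partitions k G"
  then obtain V where P: "P = image_mset V (mset_set {1..k})"
    and V: "\<forall>i\<in>{1..k}. independent_set G (V i)" "disjoint_family_on V {1..k}"
      "(\<Union>i\<in>{1..k}. V i) = pverts G"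
    by (auto simp: stable_partitions_def)
  let ?C = "V ` {1..k} - {{}}"
  have "P = pad k ?C" "card ?C \<le> k"
    using image_mset_disjoint_family[OF _ V(2)] by (simp_all add: P)
  moreover have "partition_on (pverts G) ?C"
  proof (rule partition_onI)
    show "\<Union>?C = pverts G" using V(3) by blast
    fix A B assume "A \<in> ?C" "B \<in> ?C" "A \<noteq> B"
    then obtain i j where "A = V i" "B = V j" "i \<in> {1..k}" "j \<in> {1..k}" "i \<noteq> j" by blast
    then show "disjnt A B" using V(2) by (simp add: disjoint_family_on_def disjnt_def)
  qed auto
  ultimately show "P \<in> pad k ` {C. partition_on (pverts G) C \<and> (\<forall>A\<in>C. independent_set G A) \<and> card C \<le> k}"
    using V(1) by auto
next
  fix P assume "P \<in> pad k ` {C. partition_on (pverts G) C \<and> (\<forall>A\<in>C. independent_set G A) \<and> card C \<le> k}"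
  then obtain C where P: "P = pad k C" and C: "partition_on (pverts G) C"
      "\<forall>A\<in>C. independent_set G A" "card C \<le> k"
    by auto
  have "finite C" using C(1) assms finite_elements by blast
  then obtain h where h: "bij_betw h {1..card C} C"
    using ex_bij_betw_nat_finite_1 by blast
  define V where "V i = (if i \<le> card C then h i else {})" for i
  have VC: "V i \<in> C" if "i \<in> {1..k}" "V i \<noteq> {}" for i
    using that bij_betwE[OF h] by (auto simp: V_def split: if_splits)
  have dis: "disjoint_family_on V {1..k}"
    unfolding disjoint_family_on_def
  proof (intro ballI impI)
    fix i j assume ij: "i \<in> {1..k}" "j \<in> {1..k}" "i \<noteq> j"
    show "V i \<inter> V j = {}"
    proof (cases "V i = {} \<or> V j = {}")
      case False
      then have "i \<le> card C" "j \<le> card C" by (auto simp: V_def split: if_splits)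
      then have "V i \<noteq> V j"
        using bij_betw_imp_inj_on[OF h] ij by (simp add: V_def inj_on_eq_iff)
      moreover have "V i \<in> C" "V j \<in> C" using VC ij False by blast+
      ultimately show ?thesis using partition_onD2[OF C(1)] by (simp add: disjointD)
    qed auto
  qed
  have img: "V ` {1..k} - {{}} = C"
  proof (intro equalityI subsetI)
    fix A assume "A \<in> C"
    then obtain i where "i \<in> {1..card C}" "A = h i"
      using bij_betw_imp_surj_on[OF h] by blast
    then show "A \<in> V ` {1..k} - {{}}"
      using C(3) partition_onD3[OF C(1)] \<open>A \<in> C\<close> by (auto simp: V_def intro!: image_eqI[of _ _ i])
  qed (use VC in blast)
  have "P = image_mset V (mset_set {1..k})"
    using image_mset_disjoint_family(1)[OF _ dis] by (simp add: P img[simplified])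
  moreover have "independent_set G (V i)" if "i \<in> {1..k}" for i
    using VC[OF that] C(2) by (cases "V i = {}") (auto simp: independent_set_def)
  moreover have "(\<Union>i\<in>{1..k}. V i) = pverts G"
    using partition_onD1[OF C(1)] img by blast
  ultimately show "P \<in> stable_partitions k G"
    using dis by (auto simp: stable_partitions_def)
qed

text \<open>Deleting \<open>v\<close> merges no nonempty classes and at most turns
  \<open>{v}\<close> into one more empty class, which the padding absorbs.\<close>

lemma remove_vertex_pad:
  assumes "partition_on V C" "finite V" "card C \<le> k"
  shows "remove_vertex v (pad k C) = pad k ((\<lambda>A. A - {v}) ` C - {{}})"
proof -
  have fin: "finite C" using assms finite_elements by blast
  have "disjoint_family_on (\<lambda>A. A - {v}) C"
    using partition_onD2[OF assms(1)] by (auto simp: disjoint_family_on_def disjoint_def)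
  from image_mset_disjoint_family[OF fin this] show ?thesis
    using assms(3) by (simp add: remove_vertex_def pad_def multiset_eq_iff)
qed

lemma remove_vertex_pad_eq_iff:
  assumes "partition_on V C" "partition_on V D" "finite V" "card C \<le> k" "card D \<le> k"
  shows "remove_vertex v (pad k C) = remove_vertex v (pad k D) \<longleftrightarrow>
    (\<lambda>A. A - {v}) ` C - {{}} = (\<lambda>A. A - {v}) ` D - {{}}"
proof -
  have "finite C" "finite D" using assms finite_elements by blast+
  then show ?thesis
    unfolding remove_vertex_pad[OF assms(1,3,4)] remove_vertex_pad[OF assms(2,3,5)]
    by (intro iffI pad_inject[where k = k]) simp_all
qed

section \<open>Matchings of a triangle-free graph against partitions of its complement\<close>

definition matchings :: "'a set set \<Rightarrow> nat \<Rightarrow> 'a set set set" where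
  "matchings E s = {M. M \<subseteq> E \<and> disjoint M \<and> s \<le> card M}"

definition matching_adj :: "'a set \<Rightarrow> 'a set set \<Rightarrow> 'a set set \<Rightarrow> bool" where
  "matching_adj V M N \<longleftrightarrow> M \<noteq> N \<and> (\<exists>v\<in>V. {e \<in> M. v \<notin> e} = {e \<in> N. v \<notin> e})"

definition complement_graph :: "'a set \<Rightarrow> 'a set set \<Rightarrow> 'a pair_pre_digraph" where
  "complement_graph V E =
     \<lparr>pverts = V, parcs = {(u, v). u \<in> V \<and> v \<in> V \<and> u \<noteq> v \<and> {u, v} \<notin> E}\<rparr>"

lemma pair_graph_complement_graph:
  assumes "finite V"
  shows "pair_graph (complement_graph V E)"
proof
  show "finite (parcs (complement_graph V E))"
    using assms by (auto simp: complement_graph_def intro: finite_subset[of _ "V \<times> V"])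
qed (use assms in \<open>auto simp: complement_graph_def symmetric_def sym_def insert_commute\<close>)

locale triangle_free_graph =
  fixes V :: "'a set" and E :: "'a set set"
  assumes finite_V: "finite V"
    and edge: "e \<in> E \<Longrightarrow> e \<subseteq> V \<and> card e = 2"
    and triangle_free: "{u, v} \<in> E \<Longrightarrow> {v, w} \<in> E \<Longrightarrow> {u, w} \<in> E \<Longrightarrow> False"
begin

lemma singleton_not_edge: "{v} \<notin> E"
  using edge[of "{v}"] by auto

lemma edgeE:
  assumes "e \<in> E"
  obtains u v where "e = {u, v}" "u \<noteq> v" "u \<in> V" "v \<in> V"
  using edge[OF assms] by (auto simp: card_2_iff)

lemma finite_E: "finite E"
  using edge finite_V by (intro finite_subset[of E "Pow V"]) auto

lemma finite_matching: "M \<in> matchings E s \<Longrightarrow> finite M"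
  using finite_E by (auto simp: matchings_def intro: finite_subset)

text \<open>Independence in the complement makes any two elements an edge of \<open>E\<close>, so a
  third element would complete a triangle.\<close>

lemma independent_set_complement_graph:
  "independent_set (complement_graph V E) A \<longleftrightarrow> A = {} \<or> (\<exists>v\<in>V. A = {v}) \<or> A \<in> E"
proof
  assume "independent_set (complement_graph V E) A"
  then have AV: "A \<subseteq> V" and A: "\<And>u v. u \<in> A \<Longrightarrow> v \<in> A \<Longrightarrow> u \<noteq> v \<Longrightarrow> {u, v} \<in> E"
    by (auto simp: independent_set_def complement_graph_def)
  show "A = {} \<or> (\<exists>v\<in>V. A = {v}) \<or> A \<in> E"
  proof (rule ccontr)
    assume *: "\<not> ?thesis"
    then obtain u where u: "u \<in> A" by auto
    with * AV obtain v where v: "v \<in> A" "v \<noteq> u" by blast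
    with * u A have "A \<noteq> {u, v}" by metis
    with u v obtain w where "w \<in> A" "w \<noteq> u" "w \<noteq> v" by blast
    with u v A triangle_free[of u v w] show False by metis
  qed
next
  assume "A = {} \<or> (\<exists>v\<in>V. A = {v}) \<or> A \<in> E"
  moreover have "independent_set (complement_graph V E) A" if "A \<in> E"
  proof -
    from that obtain u v where "A = {u, v}" "u \<in> V" "v \<in> V" by (rule edgeE)
    with that show ?thesis
      by (simp add: independent_set_def complement_graph_def insert_commute)
  qed
  ultimately show "independent_set (complement_graph V E) A"
    by (auto simp: independent_set_def complement_graph_def)
qed

definition classes :: "'a set set \<Rightarrow> 'a set set" where
  "classes M = M \<union> (\<lambda>v. {v}) ` (V - \<Union>M)"

lemma card_Union_matching:
  assumes "M \<in> matchings E s"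
  shows "card (\<Union>M) = 2 * card M"
proof -
  have "card (\<Union>M) = sum card M"
    using assms edge finite_V
    by (intro card_Union_disjoint)
       (auto simp: matchings_def disjoint_def pairwise_def disjnt_def intro: finite_subset)
  also have "\<dots> = (\<Sum>e\<in>M. 2)"
    using assms edge by (intro sum.cong) (auto simp: matchings_def)
  finally show ?thesis by simp
qed

lemma Union_matching_subset: "M \<in> matchings E s \<Longrightarrow> \<Union>M \<subseteq> V"
  using edge by (auto simp: matchings_def)

text \<open>Each edge merges two vertices into one class; this turns an upper bound on the classes
  into a lower bound on the edges.\<close>

lemma card_classes:
  assumes M: "M \<in> matchings E s"
  shows "card (classes M) + card M = card V"
proof -
  have "card (classes M) = card M + card ((\<lambda>v. {v}) ` (V - \<Union>M))"
    unfolding classes_def using finite_matching[OF M] finite_V M singleton_not_edge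
    by (intro card_Un_disjoint) (auto simp: matchings_def)
  also have "card ((\<lambda>v. {v}) ` (V - \<Union>M)) = card (V - \<Union>M)"
    by (intro card_image) (auto simp: inj_on_def)
  also have "\<dots> = card V - 2 * card M"
    using card_Union_matching[OF M] Union_matching_subset[OF M] finite_V
    by (metis card_Diff_subset finite_subset)
  finally show ?thesis
    using card_mono[OF finite_V Union_matching_subset[OF M]] card_Union_matching[OF M] by simp
qed

lemma classes_Int_E: "M \<subseteq> E \<Longrightarrow> classes M \<inter> E = M"
  using singleton_not_edge by (auto simp: classes_def)

lemma partition_on_classes:
  assumes "M \<in> matchings E s"
  shows "partition_on V (classes M)"
proof (rule partition_onI)
  show "{} \<notin> classes M"
    using assms edge[of "{}"] by (auto simp: classes_def matchings_def)
  show "\<Union>(classes M) = V"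
    using Union_matching_subset[OF assms] by (auto simp: classes_def)
  show "disjnt A B" if "A \<in> classes M" "B \<in> classes M" "A \<noteq> B" for A B
    using that assms by (auto simp: classes_def matchings_def disjoint_def disjnt_def)
qed

text \<open>Intersecting with \<open>E\<close> inverts \<open>classes\<close>: the classes outside
  \<open>E\<close> are singletons, namely the vertices that the classes in \<open>E\<close>
  miss.\<close>

lemma bij_betw_classes:
  assumes "s \<le> card V"
  shows "bij_betw classes (matchings E s)
    {C. partition_on V C \<and> (\<forall>A\<in>C. independent_set (complement_graph V E) A) \<and> card C \<le> card V - s}"
    (is "bij_betw _ _ ?P")
proof (rule bij_betw_byWitness[where f' = "\<lambda>C. C \<inter> E"])
  \<comment> \<open>The bound 0 comes first: the true number of edges follows from
    \<open>card_classes\<close>, which already needs a matching.\<close>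
  have part: "C \<inter> E \<in> matchings E 0 \<and> classes (C \<inter> E) = C" if "C \<in> ?P" for C
  proof
    have C: "\<Union>C = V" "disjoint C" "{} \<notin> C"
      using that by (auto simp: partition_on_def)
    have C': "(\<exists>v\<in>V. A = {v}) \<or> A \<in> E" if "A \<in> C" for A
      using that \<open>C \<in> ?P\<close> C(3) by (auto simp: independent_set_complement_graph)
    show "C \<inter> E \<in> matchings E 0" using C(2) by (auto simp: matchings_def disjoint_def)
    show "classes (C \<inter> E) = C"
    proof (intro equalityI subsetI)
      fix A assume "A \<in> classes (C \<inter> E)"
      then consider "A \<in> C" | v where "A = {v}" "v \<in> V" "v \<notin> \<Union>(C \<inter> E)"
        by (auto simp: classes_def)
      then show "A \<in> C"
      proof cases
        case (2 v)
        with C(1) obtain B where "B \<in> C" "v \<in> B" by auto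
        with 2 C'[of B] show ?thesis by auto
      qed
    next
      fix A assume A: "A \<in> C"
      show "A \<in> classes (C \<inter> E)"
      proof (cases "A \<in> E")
        case False
        with C' A obtain v where v: "v \<in> V" "A = {v}" by auto
        have "v \<notin> \<Union>(C \<inter> E)"
        proof
          assume "v \<in> \<Union>(C \<inter> E)"
          then obtain B where "B \<in> C" "B \<in> E" "v \<in> B" by auto
          then show False using disjointD[OF C(2) A, of B] v False by auto
        qed
        with v show ?thesis by (auto simp: classes_def)
      qed (use A in \<open>auto simp: classes_def\<close>)
    qed
  qed
  show "\<forall>M\<in>matchings E s. classes M \<inter> E = M"
    by (auto simp: matchings_def dest: classes_Int_E)
  show "\<forall>C\<in>?P. classes (C \<inter> E) = C"
    using part by blast
  show "classes ` matchings E s \<subseteq> ?P"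
  proof (intro image_subsetI CollectI conjI ballI)
    fix M assume M: "M \<in> matchings E s"
    show "partition_on V (classes M)" using M by (rule partition_on_classes)
    show "independent_set (complement_graph V E) A" if "A \<in> classes M" for A
      using that M by (auto simp: independent_set_complement_graph classes_def matchings_def)
    show "card (classes M) \<le> card V - s"
      using card_classes[OF M] M by (auto simp: matchings_def)
  qed
  show "(\<lambda>C. C \<inter> E) ` ?P \<subseteq> matchings E s"
  proof (intro image_subsetI)
    fix C assume C: "C \<in> ?P"
    with part[OF C] card_classes[of "C \<inter> E" 0] assms have "s \<le> card (C \<inter> E)"
      by auto
    with part[OF C] show "C \<inter> E \<in> matchings E s" by (auto simp: matchings_def)
  qed
qed

text \<open>The partner of \<open>v\<close> becomes a singleton like any uncovered vertex, so the
  surviving edges \<open>X\<close> determine everything that is left.\<close>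

lemma classes_remove_vertex:
  fixes v :: 'a
  assumes M: "M \<in> matchings E s"
  defines "X \<equiv> {e \<in> M. v \<notin> e}"
  shows "(\<lambda>A. A - {v}) ` classes M - {{}} = X \<union> (\<lambda>u. {u}) ` (V - {v} - \<Union>X)"
proof (intro equalityI subsetI)
  fix B assume "B \<in> (\<lambda>A. A - {v}) ` classes M - {{}}"
  then obtain A where A: "A \<in> classes M" and B: "B = A - {v}" "B \<noteq> {}" by auto
  show "B \<in> X \<union> (\<lambda>u. {u}) ` (V - {v} - \<Union>X)"
  proof (cases "A \<in> M")
    case True
    show ?thesis
    proof (cases "v \<in> A")
      case True
      have "A \<in> E" using \<open>A \<in> M\<close> M by (auto simp: matchings_def)
      with True obtain u where u: "A = {u, v}" "u \<noteq> v" "u \<in> V"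
        by (elim edgeE) auto
      have "u \<notin> \<Union>X"
      proof
        assume "u \<in> \<Union>X"
        then obtain e where "e \<in> M" "v \<notin> e" "u \<in> e" by (auto simp: X_def)
        moreover have "e \<inter> A = {}"
          using calculation M \<open>A \<in> M\<close> True by (intro disjointD[of M]) (auto simp: matchings_def)
        ultimately show False using u by auto
      qed
      with u B show ?thesis by auto
    qed (use \<open>A \<in> M\<close> B in \<open>auto simp: X_def\<close>)
  next
    case False
    with A B show ?thesis by (auto simp: classes_def X_def)
  qed
next
  fix B assume "B \<in> X \<union> (\<lambda>u. {u}) ` (V - {v} - \<Union>X)"
  then consider "B \<in> X" | u where "B = {u}" "u \<in> V" "u \<noteq> v" "u \<notin> \<Union>X" by auto
  then show "B \<in> (\<lambda>A. A - {v}) ` classes M - {{}}"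
  proof cases
    case 1
    then have "B \<noteq> {}" using M edge[of B] by (auto simp: X_def matchings_def)
    with 1 show ?thesis by (auto simp: X_def classes_def intro!: image_eqI[where x = B])
  next
    case (2 u)
    show ?thesis
    proof (cases "u \<in> \<Union>M")
      case True
      then obtain e where e: "e \<in> M" "u \<in> e" "v \<in> e" using 2 by (auto simp: X_def)
      with M have "e \<in> E" by (auto simp: matchings_def)
      then have "e - {v} = {u}" using e 2 by (elim edgeE) auto
      with e 2 show ?thesis by (auto simp: classes_def intro!: image_eqI[where x = e])
    next
      case False
      with 2 show ?thesis by (auto simp: classes_def intro!: image_eqI[where x = "{u}"])
    qed
  qed
qed

lemma classes_remove_vertex_eq_iff:
  assumes M: "M \<in> matchings E s" and N: "N \<in> matchings E s"
  shows "(\<lambda>A. A - {v}) ` classes M - {{}} = (\<lambda>A. A - {v}) ` classes N - {{}} \<longleftrightarrow>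
    {e \<in> M. v \<notin> e} = {e \<in> N. v \<notin> e}"
proof -
  have "((\<lambda>A. A - {v}) ` classes L - {{}}) \<inter> E = {e \<in> L. v \<notin> e}" if "L \<in> matchings E s" for L
    unfolding classes_remove_vertex[OF that]
    using that singleton_not_edge by (auto simp: matchings_def)
  note edges = this
  show ?thesis
  proof
    assume "(\<lambda>A. A - {v}) ` classes M - {{}} = (\<lambda>A. A - {v}) ` classes N - {{}}"
    from arg_cong[OF this, of "\<lambda>C. C \<inter> E"] show "{e \<in> M. v \<notin> e} = {e \<in> N. v \<notin> e}"
      unfolding edges[OF M] edges[OF N] .
  next
    assume "{e \<in> M. v \<notin> e} = {e \<in> N. v \<notin> e}"
    then show "(\<lambda>A. A - {v}) ` classes M - {{}} = (\<lambda>A. A - {v}) ` classes N - {{}}"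
      unfolding classes_remove_vertex[OF M] classes_remove_vertex[OF N] by (rule arg_cong)
  qed
qed

end

text \<open>From here on colourings disappear: it remains to name matchings by the vertices of
  \<open>H\<close>. The bound \<open>s < card V\<close> makes the number of classes
  positive.\<close>

lemma bell_realizableI_matchings:
  fixes V :: "nat set"
  assumes "triangle_free_graph V E" and s: "s < card V"
    and H: "parcs H \<subseteq> pverts H \<times> pverts H"
    and f: "bij_betw f (pverts H) (matchings E s)"
    and arcs: "\<And>x y. x \<in> pverts H \<Longrightarrow> y \<in> pverts H \<Longrightarrow>
                 (x, y) \<in> parcs H \<longleftrightarrow> matching_adj V (f x) (f y)"
  shows "bell_realizable H"
proof -
  interpret triangle_free_graph V E by fact
  define G where "G = complement_graph V E"
  define k where "k = card V - s"
  define \<C> where "\<C> = {C. partition_on V C \<and> (\<forall>A\<in>C. independent_set G A) \<and> card C \<le> k}"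
  have [simp]: "pverts G = V" by (simp add: G_def complement_graph_def)
  have stable: "stable_partitions k G = pad k ` \<C>"
    using stable_partitions_eq_pad[of G k] finite_V by (simp add: \<C>_def)
  have cl: "bij_betw classes (matchings E s) \<C>"
    using bij_betw_classes[of s] s by (simp add: \<C>_def G_def k_def)
  have "inj_on (pad k) \<C>"
    using finite_V finite_elements
    by (intro inj_onI pad_inject[where k = k]) (auto simp: \<C>_def partition_on_def)
  then have pad: "bij_betw (pad k) \<C> (stable_partitions k G)"
    unfolding stable by (rule inj_on_imp_bij_betw)
  define F where "F = pad k \<circ> classes \<circ> f"
  have F: "bij_betw F (pverts H) (stable_partitions k G)"
    unfolding F_def using bij_betw_trans[OF bij_betw_trans[OF f cl] pad] by (simp add: comp_assoc)
  have "digraph_iso (with_proj (bell_graph k G)) (with_proj H)"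
  proof (rule digraph_iso_with_projI)
    show "bij_betw F (pverts H) (pverts (bell_graph k G))"
      using F by (simp add: bell_graph_def)
    fix x y assume xy: "x \<in> pverts H" "y \<in> pverts H"
    have mem: "f x \<in> matchings E s" "f y \<in> matchings E s"
      using f xy by (auto simp: bij_betw_def)
    then have "classes (f x) \<in> \<C>" "classes (f y) \<in> \<C>"
      using cl by (auto simp: bij_betw_def)
    then have "remove_vertex v (F x) = remove_vertex v (F y) \<longleftrightarrow>
        {e \<in> f x. v \<notin> e} = {e \<in> f y. v \<notin> e}" for v
      using finite_V mem
      by (simp add: F_def \<C>_def remove_vertex_pad_eq_iff[where V = V] classes_remove_vertex_eq_iff)
    moreover have "F x = F y \<longleftrightarrow> f x = f y"
      using F f xy by (auto simp: bij_betw_def inj_on_eq_iff)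
    ultimately show "(x, y) \<in> parcs H \<longleftrightarrow> (F x, F y) \<in> parcs (bell_graph k G)"
      using arcs[OF xy] F xy by (auto simp: bell_graph_def matching_adj_def bij_betw_def)
  qed (use H in \<open>auto simp: bell_graph_def\<close>)
  moreover have "pair_graph G"
    unfolding G_def using finite_V by (rule pair_graph_complement_graph)
  moreover have "0 < k" using s by (simp add: k_def)
  ultimately show ?thesis by (auto simp: bell_realizable_def)
qed

section \<open>Systems of distinct representatives\<close>

text \<open>Systems of distinct representatives of the family \<open>S\<close>, indexed by \<open>B\<close>.\<close>

definition sdrs :: "'b set \<Rightarrow> ('b \<Rightarrow> 'a set) \<Rightarrow> ('b \<Rightarrow> 'a) set" where
  "sdrs B S = {f \<in> PiE B S. inj_on f B}"

definition sdr_adj :: "'b set \<Rightarrow> ('b \<Rightarrow> 'a) \<Rightarrow> ('b \<Rightarrow> 'a) \<Rightarrow> bool" where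
  "sdr_adj B f g \<longleftrightarrow> f \<noteq> g \<and> (\<exists>b\<in>B. \<forall>c\<in>B - {b}. f c = g c)"

lemma sdr_adj_sym: "sdr_adj B f g \<longleftrightarrow> sdr_adj B g f"
  by (simp add: sdr_adj_def eq_commute)

lemma sdr_adjI:
  assumes "b \<in> B" "f b \<noteq> g b" "\<And>c. c \<in> B \<Longrightarrow> c \<noteq> b \<Longrightarrow> f c = g c"
  shows "sdr_adj B f g"
  using assms unfolding sdr_adj_def by (intro conjI bexI[of _ b]) auto

lemma not_sdr_adjI:
  assumes "a \<in> B" "b \<in> B" "a \<noteq> b" "f a \<noteq> g a" "f b \<noteq> g b"
  shows "\<not> sdr_adj B f g"
  using assms unfolding sdr_adj_def by (metis DiffI singletonD)

text \<open>
  The graph whose complement is coloured is bipartite with sides \<open>B\<close> and \<open>A\<close>; in a partition into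
  \<open>card A\<close> classes every element of \<open>B\<close> must be matched.
\<close>

lemma bell_realizableI_sdrs:
  fixes B :: "'b set" and A :: "'a set"
  assumes fin: "finite B" "finite A" "A \<noteq> {}" and S: "\<And>b. b \<in> B \<Longrightarrow> S b \<subseteq> A"
    and H: "parcs H \<subseteq> pverts H \<times> pverts H"
    and f: "bij_betw f (pverts H) (sdrs B S)"
    and arcs: "\<And>x y. x \<in> pverts H \<Longrightarrow> y \<in> pverts H \<Longrightarrow> (x, y) \<in> parcs H \<longleftrightarrow> sdr_adj B (f x) (f y)"
  shows "bell_realizable H"
proof -
  obtain \<beta>0 :: "'b \<Rightarrow> nat" where \<beta>0: "inj_on \<beta>0 B"
    using finite_imp_inj_to_nat_seg[OF fin(1)] by blast
  obtain \<alpha>0 :: "'a \<Rightarrow> nat" where \<alpha>0: "inj_on \<alpha>0 A"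
    using finite_imp_inj_to_nat_seg[OF fin(2)] by blast
  \<comment> \<open>Even and odd numbers give disjoint copies of the two sides, and parity is the
    2-colouring that excludes triangles.\<close>
  define \<beta> where "\<beta> b = 2 * \<beta>0 b" for b
  define \<alpha> where "\<alpha> a = 2 * \<alpha>0 a + 1" for a
  have even_\<beta>: "even (\<beta> b)" and odd_\<alpha>: "odd (\<alpha> a)" for a b
    by (auto simp: \<alpha>_def \<beta>_def)
  have ne [simp]: "\<beta> b \<noteq> \<alpha> a" "\<alpha> a \<noteq> \<beta> b" for a b
    using even_\<beta>[of b] odd_\<alpha>[of a] by metis+
  have \<beta>_eq: "\<beta> b = \<beta> c \<longleftrightarrow> b = c" if "b \<in> B" "c \<in> B" for b c
    using \<beta>0 that by (auto simp: \<beta>_def inj_on_eq_iff)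
  have \<alpha>_eq: "\<alpha> a = \<alpha> c \<longleftrightarrow> a = c" if "a \<in> A" "c \<in> A" for a c
    using \<alpha>0 that by (auto simp: \<alpha>_def inj_on_eq_iff)
  define V where "V = \<beta> ` B \<union> \<alpha> ` A"
  define ed where "ed b a = {\<beta> b, \<alpha> a}" for b a
  define E where "E = {ed b a | b a. b \<in> B \<and> a \<in> S b}"
  have ed_eq: "ed b a = ed c d \<longleftrightarrow> b = c \<and> a = d" if "b \<in> B" "c \<in> B" "a \<in> A" "d \<in> A" for a b c d
    using that by (auto simp: ed_def doubleton_eq_iff \<alpha>_eq \<beta>_eq)
  have ed_meet: "ed b a \<inter> ed c d = {} \<longleftrightarrow> b \<noteq> c \<and> a \<noteq> d"
    if "b \<in> B" "c \<in> B" "a \<in> A" "d \<in> A" for a b c d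
    using that by (auto simp: ed_def \<alpha>_eq \<beta>_eq)
  have parity: "even u \<noteq> even v" if "{u, v} \<in> E" for u v
    using that even_\<beta> odd_\<alpha> by (auto simp: E_def ed_def doubleton_eq_iff)
  interpret triangle_free_graph V E
  proof
    show "finite V" using fin by (simp add: V_def)
    show "e \<subseteq> V \<and> card e = 2" if "e \<in> E" for e
      using that S by (fastforce simp: E_def ed_def V_def)
    show False if "{u, v} \<in> E" "{v, w} \<in> E" "{u, w} \<in> E" for u v w
      using that[THEN parity] by blast
  qed
  define graph where "graph g = (\<lambda>b. ed b (g b)) ` B" for g
  have sdr: "g b \<in> S b" "g b \<in> A" if "g \<in> sdrs B S" "b \<in> B" for g b
    using that S by (auto simp: sdrs_def)
  have sdr_inj: "inj_on g B" if "g \<in> sdrs B S" for g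
    using that by (simp add: sdrs_def)
  have ed_graph: "ed b a \<in> graph g \<longleftrightarrow> a = g b" if "g \<in> sdrs B S" "b \<in> B" "a \<in> A" for g a b
    using that sdr by (auto simp: graph_def ed_eq)
  have inj_graph: "inj_on graph (sdrs B S)"
  proof (rule inj_onI)
    fix g h assume g: "g \<in> sdrs B S" and h: "h \<in> sdrs B S" and eq: "graph g = graph h"
    have "g b = h b" if "b \<in> B" for b
      using ed_graph[OF g that] ed_graph[OF h that] sdr(2)[OF g that] eq by blast
    then show "g = h" using g h by (auto simp: sdrs_def intro: PiE_ext)
  qed
  have graph_matching: "graph g \<in> matchings E (card B)" if g: "g \<in> sdrs B S" for g
  proof -
    have "inj_on (\<lambda>b. ed b (g b)) B"
      using sdr(2)[OF g] by (auto simp: inj_on_def ed_eq)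
    then have "card (graph g) = card B" by (simp add: graph_def card_image)
    moreover have "disjoint (graph g)"
    proof (rule disjointI)
      fix d e assume "d \<in> graph g" "e \<in> graph g" "d \<noteq> e"
      then obtain b c where "b \<in> B" "c \<in> B" "d = ed b (g b)" "e = ed c (g c)" "b \<noteq> c"
        by (auto simp: graph_def)
      then show "d \<inter> e = {}"
        using sdr(2)[OF g] sdr_inj[OF g] by (simp add: ed_meet inj_on_eq_iff)
    qed
    moreover have "graph g \<subseteq> E" using sdr[OF g] by (auto simp: graph_def E_def)
    ultimately show ?thesis by (simp add: matchings_def)
  qed
  have graph_surj: "\<exists>g\<in>sdrs B S. graph g = M" if M: "M \<in> matchings E (card B)" for M
  proof -
    have ME: "M \<subseteq> E" and dis: "disjoint M" and card: "card B \<le> card M"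
      using M by (auto simp: matchings_def)
    \<comment> \<open>\<open>C\<close> collects the elements of \<open>B\<close> that
      \<open>M\<close> covers. Edges sharing an element of \<open>B\<close> coincide, so
      \<open>M\<close> has one edge for each element of \<open>C\<close>, and
      \<open>card B \<le> card M\<close> forces \<open>C = B\<close>.\<close>
    define C where "C = {b \<in> B. \<exists>a\<in>S b. ed b a \<in> M}"
    obtain h where h: "\<And>b. b \<in> C \<Longrightarrow> h b \<in> S b \<and> ed b (h b) \<in> M"
      unfolding C_def by (atomize_elim, intro choice) auto
    have uniq: "a = h b" if "ed b a \<in> M" "b \<in> B" "a \<in> S b" for a b
    proof -
      have "b \<in> C" using that by (auto simp: C_def)
      then have "ed b a = ed b (h b)"
        using disjointD[OF dis that(1), of "ed b (h b)"] h[of b] ed_meet[of b b a "h b"] that S by blast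
      with \<open>b \<in> C\<close> h[of b] that S show ?thesis by (metis ed_eq subsetD)
    qed
    have img: "M = (\<lambda>b. ed b (h b)) ` C"
    proof (intro equalityI subsetI)
      fix e assume e: "e \<in> M"
      with ME obtain b a where "e = ed b a" "b \<in> B" "a \<in> S b" by (auto simp: E_def)
      with e uniq[of b a] show "e \<in> (\<lambda>b. ed b (h b)) ` C" by (auto simp: C_def)
    qed (use h in auto)
    have CB: "C \<subseteq> B" by (auto simp: C_def)
    have "card M \<le> card C"
      unfolding img using CB fin by (meson card_image_le finite_subset)
    with card CB fin have [simp]: "C = B" by (intro card_seteq) auto
    have "inj_on h B"
    proof (rule inj_onI)
      fix b c assume bc: "b \<in> B" "c \<in> B" "h b = h c"
      then have "ed b (h b) = ed c (h c)"
        using disjointD[OF dis, of "ed b (h b)" "ed c (h c)"] h[of b] h[of c] S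
          ed_meet[of b c "h b" "h c"] by auto
      with bc h[of b] h[of c] S ed_eq[of b c "h b" "h c"] show "b = c" by auto
    qed
    then have "restrict h B \<in> sdrs B S" using h by (auto simp: sdrs_def)
    moreover have "graph (restrict h B) = M" by (auto simp: graph_def img)
    ultimately show ?thesis by blast
  qed
  have graph: "bij_betw graph (sdrs B S) (matchings E (card B))"
    using inj_graph graph_matching graph_surj unfolding bij_betw_def by blast
  have adj: "matching_adj V (graph g) (graph h) \<longleftrightarrow> sdr_adj B g h"
    if g: "g \<in> sdrs B S" and h: "h \<in> sdrs B S" for g h
  proof
    assume "matching_adj V (graph g) (graph h)"
    then obtain v where v: "v \<in> V" "{e \<in> graph g. v \<notin> e} = {e \<in> graph h. v \<notin> e}" and "g \<noteq> h"
      by (auto simp: matching_adj_def)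
    have same: "g c = h c" if "c \<in> B" "v \<notin> ed c (g c) \<or> v \<notin> ed c (h c)" for c
    proof -
      have "ed c (g c) \<in> graph g" "ed c (h c) \<in> graph h"
        using that by (auto simp: graph_def)
      with v(2) that(2) have "ed c (g c) \<in> graph h \<or> ed c (h c) \<in> graph g" by blast
      then show ?thesis
        using ed_graph[OF g that(1)] ed_graph[OF h that(1)] sdr(2)[OF g that(1)] sdr(2)[OF h that(1)]
        by auto
    qed
    from v(1) consider b where "b \<in> B" "v = \<beta> b" | a where "a \<in> A" "v = \<alpha> a"
      by (auto simp: V_def)
    then show "sdr_adj B g h"
    proof cases
      case (1 b)
      have "g c = h c" if "c \<in> B - {b}" for c
        using that 1 by (intro same) (auto simp: ed_def \<beta>_eq)
      with 1 \<open>g \<noteq> h\<close> show ?thesis by (auto simp: sdr_adj_def)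
    next
      \<comment> \<open>A vertex of the side \<open>A\<close> cannot be the witness: if
        \<open>g\<close> and \<open>h\<close> differ at \<open>c\<close>, both edges at
        \<open>c\<close> contain \<open>\<alpha> a\<close>, so both values are
        \<open>a\<close>.\<close>
      case (2 a)
      have "g c = h c" if c: "c \<in> B" for c
      proof (rule ccontr)
        assume *: "g c \<noteq> h c"
        then have "v \<in> ed c (g c)" "v \<in> ed c (h c)" using same[OF c] by blast+
        then have "a = g c" "a = h c"
          using 2 sdr(2)[OF g c] sdr(2)[OF h c] by (auto simp: ed_def \<alpha>_eq)
        with * show False by simp
      qed
      then have "g = h" using g h by (auto simp: sdrs_def intro: PiE_ext)
      with \<open>g \<noteq> h\<close> show ?thesis by contradiction
    qed
  next
    assume "sdr_adj B g h"
    then obtain b where b: "b \<in> B" "\<forall>c\<in>B - {b}. g c = h c" and "g \<noteq> h"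
      by (auto simp: sdr_adj_def)
    have "{e \<in> graph k. \<beta> b \<notin> e} = (\<lambda>c. ed c (k c)) ` (B - {b})" for k :: "'b \<Rightarrow> 'a"
      using b(1) by (auto simp: graph_def ed_def \<beta>_eq)
    moreover have "(\<lambda>c. ed c (g c)) ` (B - {b}) = (\<lambda>c. ed c (h c)) ` (B - {b})"
      using b(2) by (intro image_cong) auto
    moreover have "\<beta> b \<in> V" using b(1) by (simp add: V_def)
    moreover have "graph g \<noteq> graph h"
      using \<open>g \<noteq> h\<close> inj_graph g h by (auto dest: inj_onD)
    ultimately show "matching_adj V (graph g) (graph h)"
      unfolding matching_adj_def by metis
  qed
  have "card V = card B + card A"
    unfolding V_def using fin \<alpha>_eq \<beta>_eq
    by (subst card_Un_disjoint) (auto simp: card_image inj_on_def)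
  moreover have "0 < card A" using fin by (simp add: card_gt_0_iff)
  ultimately have "card B < card V" by simp
  moreover have "bij_betw (graph \<circ> f) (pverts H) (matchings E (card B))"
    using f graph by (rule bij_betw_trans)
  moreover have "(x, y) \<in> parcs H \<longleftrightarrow> matching_adj V ((graph \<circ> f) x) ((graph \<circ> f) y)"
    if "x \<in> pverts H" "y \<in> pverts H" for x y
    using that arcs adj bij_betwE[OF f] by simp
  ultimately show ?thesis
    by (intro bell_realizableI_matchings[OF triangle_free_graph_axioms _ H])
qed

section \<open>Trees\<close>

text \<open>Growing a tree leaf by leaf provides the induction that \<open>is_tree\<close>, phrased
  through cycles of a digraph, does not offer.\<close>

inductive leaf_built :: "'a set \<Rightarrow> 'a set set \<Rightarrow> bool" where
  single: "leaf_built {v} {}"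
| leaf: "leaf_built V F \<Longrightarrow> u \<in> V \<Longrightarrow> w \<notin> V \<Longrightarrow> leaf_built (insert w V) (insert {u, w} F)"

lemma leaf_built_edge:
  assumes "leaf_built V F" "e \<in> F"
  shows "e \<subseteq> V \<and> card e = 2"
  using assms by (induction arbitrary: e) (auto simp: card_2_iff)

lemma leaf_built_finite:
  assumes "leaf_built V F"
  shows "finite V" "finite F"
  using assms by (induction) auto

text \<open>Used to close a cycle: an edge outside \<open>F\<close> together with a walk in
  \<open>F\<close> between its ends.\<close>

lemma leaf_built_connected:
  assumes "leaf_built V F" "x \<in> V" "y \<in> V"
  shows "(x, y) \<in> {(x, y). {x, y} \<in> F}\<^sup>*"
  using assms
proof (induction arbitrary: x y)
  case (leaf V F u w)
  let ?R = "{(x, y). {x, y} \<in> insert {u, w} F}"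
  have sub: "{(x, y). {x, y} \<in> F}\<^sup>* \<subseteq> ?R\<^sup>*" by (intro rtrancl_mono) auto
  have u: "(x, u) \<in> ?R\<^sup>*" "(u, x) \<in> ?R\<^sup>*" if "x \<in> insert w V" for x
  proof -
    have "(w, u) \<in> ?R" "(u, w) \<in> ?R" by auto
    then have "(w, u) \<in> ?R\<^sup>*" "(u, w) \<in> ?R\<^sup>*" by blast+
    with that leaf.IH[of x u] leaf.IH[of u x] leaf.hyps sub
    show "(x, u) \<in> ?R\<^sup>*" "(u, x) \<in> ?R\<^sup>*" by auto
  qed
  from u(1)[OF leaf.prems(1)] u(2)[OF leaf.prems(2)] show ?case by (rule rtrancl_trans)
qed auto

text \<open>
  A representative of every edge is chosen among its two ends; \<open>f x\<close> is the choice that misses only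
  the vertex \<open>x\<close>, so every edge picks its end far from \<open>x\<close>.
\<close>

lemma leaf_built_sdrs:
  assumes "leaf_built V F"
  shows "\<exists>f. bij_betw f V (sdrs F (\<lambda>e. e)) \<and> (\<forall>x\<in>V. f x ` F = V - {x}) \<and>
    (\<forall>x\<in>V. \<forall>y\<in>V. {x, y} \<in> F \<longleftrightarrow> sdr_adj F (f x) (f y))"
  using assms
proof induction
  case (single v)
  have "bij_betw (\<lambda>_ _. undefined) {v} (sdrs {} (\<lambda>e. e))"
    by (auto simp: bij_betw_def sdrs_def)
  then show ?case by (intro exI[of _ "\<lambda>_ _. undefined"]) (auto simp: sdr_adj_def)
next
  case (leaf V F u w)
  then obtain f where f: "bij_betw f V (sdrs F (\<lambda>e. e))"
    and img: "\<And>x. x \<in> V \<Longrightarrow> f x ` F = V - {x}"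
    and adj: "\<And>x y. x \<in> V \<Longrightarrow> y \<in> V \<Longrightarrow> {x, y} \<in> F \<longleftrightarrow> sdr_adj F (f x) (f y)"
    by metis
  define e where "e = {u, w}"
  have eF: "e \<notin> F" using leaf_built_edge[OF leaf.hyps(1), of e] leaf.hyps by (auto simp: e_def)
  have uw: "u \<noteq> w" using leaf.hyps by auto
  have sdr: "f x \<in> F \<rightarrow>\<^sub>E \<Union>F" "\<And>d. d \<in> F \<Longrightarrow> f x d \<in> d" "inj_on (f x) F"
    if "x \<in> V" for x
    using bij_betwE[OF f] that by (auto simp: sdrs_def PiE_iff extensional_def)
  have f_inj: "f x = f y \<longleftrightarrow> x = y" if "x \<in> V" "y \<in> V" for x y
    using f that by (auto simp: bij_betw_def inj_on_eq_iff)
  \<comment> \<open>For an old missed vertex \<open>x\<close>, the end of \<open>e\<close> far from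
    \<open>x\<close> is \<open>w\<close>. If \<open>w\<close> is missed, \<open>e\<close> must pick
    \<open>u\<close>, so the old edges have to miss \<open>u\<close>, which is
    \<open>f u\<close>.\<close>
  define g where "g x = (if x = w then (f u)(e := u) else (f x)(e := w))" for x
  have g_e: "g x e = (if x = w then u else w)" for x by (simp add: g_def)
  have g_F: "g x d = (if x = w then f u d else f x d)" if "d \<in> F" for x d
    using eF that by (auto simp: g_def)
  have g_img: "g x ` insert e F = insert w V - {x}" if "x \<in> insert w V" for x
  proof -
    have "g x ` F = (if x = w then f u else f x) ` F"
      using g_F by (intro image_cong) auto
    then show ?thesis
      using that img leaf.hyps uw by (auto simp: g_e)
  qed
  have g_sdr: "g x \<in> sdrs (insert e F) (\<lambda>e. e)" if "x \<in> insert w V" for x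
  proof -
    define y where "y = (if x = w then u else x)"
    have y: "y \<in> V" using that leaf.hyps by (auto simp: y_def)
    have gy: "g x d = f y d" if "d \<in> F" for d using that by (simp add: g_F y_def)
    have "inj_on (g x) F" using sdr(3)[OF y] gy by (simp cong: inj_on_cong)
    moreover have "g x e \<notin> g x ` F"
    proof -
      have "g x ` F = V - {y}" using img[OF y] gy by (metis image_cong)
      then show ?thesis using leaf.hyps by (auto simp: g_e y_def)
    qed
    ultimately have "inj_on (g x) (insert e F)" using eF by simp
    moreover have "g x \<in> (\<Pi>\<^sub>E d\<in>insert e F. d)"
    proof (rule PiE_I)
      fix d assume "d \<in> insert e F"
      moreover have "g x e \<in> {u, w}" by (simp add: g_e)
      then have "g x e \<in> e" unfolding e_def[symmetric] .
      ultimately show "g x d \<in> d" using sdr(2)[OF y] gy by auto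
    next
      fix d assume "d \<notin> insert e F"
      then show "g x d = undefined" using sdr(1)[OF y] by (auto simp: g_def y_def)
    qed
    ultimately show ?thesis by (simp add: sdrs_def)
  qed
  have g_inj: "inj_on g (insert w V)"
  proof (rule inj_onI)
    fix x y assume "x \<in> insert w V" "y \<in> insert w V" "g x = g y"
    with g_img[of x] g_img[of y] show "x = y" by auto
  qed
  have g_surj: "\<exists>x\<in>insert w V. g x = h" if h: "h \<in> sdrs (insert e F) (\<lambda>e. e)" for h
  proof -
    have he: "h e = u \<or> h e = w" and hF: "\<And>d. d \<in> F \<Longrightarrow> h d \<in> d" and inj: "inj_on h (insert e F)"
      and ext: "\<And>d. d \<notin> insert e F \<Longrightarrow> h d = undefined"
      using h by (auto simp: sdrs_def e_def PiE_iff extensional_def)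
    have "restrict h F \<in> sdrs F (\<lambda>e. e)"
      using hF inj by (auto simp: sdrs_def inj_on_insert)
    then obtain y where y: "y \<in> V" "f y = restrict h F"
      using f by (metis bij_betw_imp_surj_on imageE)
    have hy: "h = (f y)(e := h e)"
      using ext by (auto simp: y fun_eq_iff)
    show ?thesis
    \<comment> \<open>On \<open>F\<close> the system \<open>h\<close> is some \<open>f y\<close>. If
      \<open>e\<close> picks \<open>w\<close>, then \<open>h\<close> misses \<open>y\<close>; if
      \<open>e\<close> picks \<open>u\<close>, no edge of \<open>F\<close> does, so
      \<open>y = u\<close> and \<open>h\<close> misses \<open>w\<close>.\<close>
    proof (cases "h e = w")
      case True
      then have "g y = h" using y hy leaf.hyps by (auto simp: g_def)
      with y show ?thesis by auto
    next
      case False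
      with he have "h e = u" by auto
      moreover have "h e \<notin> f y ` F" using inj eF by (auto simp: y inj_on_insert)
      ultimately have "u = y" using img[OF y(1)] leaf.hyps by auto
      with \<open>h e = u\<close> hy have "g w = h" by (auto simp: g_def)
      then show ?thesis by auto
    qed
  qed
  have g: "bij_betw g (insert w V) (sdrs (insert e F) (\<lambda>e. e))"
    unfolding bij_betw_def
  proof (intro conjI g_inj equalityI image_subsetI subsetI g_sdr)
    fix h assume "h \<in> sdrs (insert e F) (\<lambda>e. e)"
    from g_surj[OF this] show "h \<in> g ` insert w V" by auto
  qed
  \<comment> \<open>Both systems pick \<open>w\<close> at \<open>e\<close>, so a coordinate where
    they differ lies in \<open>F\<close>.\<close>
  have adj_old: "{x, y} \<in> insert e F \<longleftrightarrow> sdr_adj (insert e F) (g x) (g y)" if "x \<in> V" "y \<in> V" for x y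
  proof -
    have xy: "x \<noteq> w" "y \<noteq> w" using that leaf.hyps by auto
    have "f x \<noteq> f y \<and> (\<exists>b\<in>F. \<forall>c\<in>F - {b}. f x c = f y c) \<longleftrightarrow>
      f x \<noteq> f y \<and> (\<exists>b\<in>insert e F. \<forall>c\<in>insert e F - {b}. g x c = g y c)" (is "?L \<longleftrightarrow> ?R")
    proof
      assume L: ?L
      then obtain b where b: "b \<in> F" "\<forall>c\<in>F - {b}. f x c = f y c" by blast
      have "g x c = g y c" if "c \<in> insert e F - {b}" for c
        using that b(2) xy by (cases "c = e") (simp_all add: g_e g_F)
      with L b(1) show ?R by blast
    next
      assume R: ?R
      then obtain b where b: "b \<in> insert e F" "\<forall>c\<in>insert e F - {b}. g x c = g y c" by blast
      have "f x = f y" if "b = e"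
      proof (rule PiE_ext)
        show "f x \<in> F \<rightarrow>\<^sub>E \<Union>F" "f y \<in> F \<rightarrow>\<^sub>E \<Union>F" using sdr(1) \<open>x \<in> V\<close> \<open>y \<in> V\<close> by auto
        fix c assume "c \<in> F"
        with b that eF xy g_F show "f x c = f y c" by fastforce
      qed
      with R have "b \<in> F" using b(1) by auto
      moreover have "f x c = f y c" if "c \<in> F - {b}" for c
        using b(2) that xy g_F[of c x] g_F[of c y] by auto
      ultimately show ?L using R by blast
    qed
    moreover have "g x = g y \<longleftrightarrow> f x = f y"
      using that f_inj g_inj by (auto simp: inj_on_eq_iff)
    moreover have "{x, y} \<in> insert e F \<longleftrightarrow> {x, y} \<in> F"
      using xy by (auto simp: e_def doubleton_eq_iff)
    ultimately show ?thesis using adj[OF that] by (simp add: sdr_adj_def)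
  qed
  \<comment> \<open>\<open>g x\<close> and \<open>g w\<close> differ at \<open>e\<close>, so they
    are adjacent only if they agree on \<open>F\<close>, that is, if \<open>f x = f u\<close>; and
    \<open>u\<close> is the one neighbour of \<open>w\<close>.\<close>
  have adj_new: "{x, w} \<in> insert e F \<longleftrightarrow> sdr_adj (insert e F) (g x) (g w)" if x: "x \<in> V" for x
  proof -
    have "x \<noteq> w" using x leaf.hyps by auto
    have "{x, w} \<in> insert e F \<longleftrightarrow> x = u"
      using leaf_built_edge[OF leaf.hyps(1), of "{x, w}"] leaf.hyps \<open>x \<noteq> w\<close>
      by (auto simp: e_def doubleton_eq_iff)
    also have "x = u \<longleftrightarrow> f x = f u" using f_inj x leaf.hyps by simp
    also have "f x = f u \<longleftrightarrow> (\<forall>c\<in>F. g x c = g w c)"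
    proof
      assume "\<forall>c\<in>F. g x c = g w c"
      then show "f x = f u"
        using sdr(1)[OF x] sdr(1)[OF leaf.hyps(2)] \<open>x \<noteq> w\<close>
        by (intro PiE_ext) (auto simp: g_F)
    qed (use \<open>x \<noteq> w\<close> g_F in auto)
    also have "\<dots> \<longleftrightarrow> sdr_adj (insert e F) (g x) (g w)"
    proof
      have ne: "g x e \<noteq> g w e" using uw \<open>x \<noteq> w\<close> by (simp add: g_e)
      show "sdr_adj (insert e F) (g x) (g w)" if "\<forall>c\<in>F. g x c = g w c"
        unfolding sdr_adj_def
      proof (intro conjI bexI[of _ e])
        show "g x \<noteq> g w" using ne by auto
      qed (use that in auto)
      show "\<forall>c\<in>F. g x c = g w c" if "sdr_adj (insert e F) (g x) (g w)"
      proof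
        from that obtain b where b: "\<forall>c\<in>insert e F - {b}. g x c = g w c"
          by (auto simp: sdr_adj_def)
        with ne have "b = e" by auto
        then show "g x c = g w c" if "c \<in> F" for c
          using that b eF by auto
      qed
    qed
    finally show ?thesis .
  qed
  have "{w} \<notin> insert e F"
    using leaf_built_edge[OF leaf.hyps(1), of "{w}"] uw by (auto simp: e_def)
  then have adj_w: "{w, w} \<in> insert e F \<longleftrightarrow> sdr_adj (insert e F) (g w) (g w)"
    by (simp add: sdr_adj_def)
  have adj_g: "{x, y} \<in> insert e F \<longleftrightarrow> sdr_adj (insert e F) (g x) (g y)"
    if x: "x \<in> insert w V" and y: "y \<in> insert w V" for x y
  proof -
    consider "x \<in> V" "y \<in> V" | "x \<in> V" "y = w" | "x = w" "y \<in> V" | "x = w" "y = w"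
      using x y by blast
    then show ?thesis
    proof cases
      case 3
      then show ?thesis
        using adj_new[OF 3(2)] sdr_adj_sym[of "insert e F" "g y" "g w"]
        by (simp only: insert_commute[of w y])
    qed (simp_all only: adj_old adj_new adj_w)
  qed
  show ?case
    unfolding e_def[symmetric] by (intro exI[of _ g] conjI ballI g g_img adj_g)
qed

section \<open>From connected graphs without cycles to the construction by leaves\<close>

lemma rtrancl_leaves_set:
  assumes "(x, y) \<in> R\<^sup>*" "x \<in> S" "y \<notin> S"
  shows "\<exists>u\<in>S. \<exists>w. w \<notin> S \<and> (u, w) \<in> R"
  using assms by (induction rule: rtrancl_induct) blast+

text \<open>A maximal leaf-built subgraph spans \<open>T\<close>, since connectedness gives an arc
  leaving any smaller vertex set; an edge of \<open>T\<close> outside it would close a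
  cycle.\<close>

lemma is_tree_leaf_built:
  assumes "is_tree T"
  shows "leaf_built (pverts T) {{u, v} | u v. (u, v) \<in> parcs T}"
proof -
  interpret pair_graph T using assms by (simp add: is_tree_def)
  let ?E = "{{u, v} | u v. (u, v) \<in> parcs T}"
  have sym: "(v, u) \<in> parcs T" if "(u, v) \<in> parcs T" for u v
    using pair_sym_arcs that by (auto simp: symmetric_def sym_def)
  have conn: "(u, v) \<in> (parcs T)\<^sup>*" if "u \<in> pverts T" "v \<in> pverts T" for u v
  proof -
    have "u \<rightarrow>\<^sup>*\<^bsub>mk_symmetric (with_proj T)\<^esub> v"
      using assms that by (auto simp: is_tree_def connected_def strongly_connected_def)
    then have "u \<rightarrow>\<^sup>*\<^bsub>with_proj T\<^esub> v"
      using reachable_mk_symmetric_eq[OF pair_sym_arcs] by simp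
    from reachable_rtranclI[OF this] show ?thesis by simp
  qed
  obtain r where r: "r \<in> pverts T"
    using assms by (auto simp: is_tree_def connected_def strongly_connected_def)
  define \<S> where "\<S> = {S. S \<subseteq> pverts T \<and> (\<exists>F\<subseteq>?E. leaf_built S F)}"
  have "{r} \<in> \<S>" using r by (auto simp: \<S>_def intro: leaf_built.single exI[of _ "{}"])
  moreover have "finite \<S>"
    using pair_finite_verts by (auto simp: \<S>_def intro: finite_subset[of _ "Pow (pverts T)"])
  ultimately obtain S where S: "S \<in> \<S>" and max: "\<And>S'. S' \<in> \<S> \<Longrightarrow> S \<subseteq> S' \<Longrightarrow> S = S'"
    using finite_has_maximal[of \<S>] by auto
  from S obtain F where F: "F \<subseteq> ?E" "leaf_built S F" "S \<subseteq> pverts T" by (auto simp: \<S>_def)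
  have "S \<noteq> {}" using F(2) by (cases) auto
  have S_eq: "S = pverts T"
  proof (rule ccontr)
    assume "S \<noteq> pverts T"
    with F(3) \<open>S \<noteq> {}\<close> obtain x y where "x \<in> S" "y \<in> pverts T" "y \<notin> S" by blast
    with conn[of x y] F(3) obtain u w where uw: "u \<in> S" "w \<notin> S" "(u, w) \<in> parcs T"
      using rtrancl_leaves_set[of x y "parcs T" S] by blast
    have "leaf_built (insert w S) (insert {u, w} F)" using F(2) uw(1,2) by (rule leaf_built.leaf)
    moreover have "insert {u, w} F \<subseteq> ?E" using F(1) uw(3) by auto
    moreover have "insert w S \<subseteq> pverts T" using F(3) uw(3) in_arcsD2 by auto
    ultimately have "insert w S \<in> \<S>" unfolding \<S>_def by blast
    with max[of "insert w S"] uw(2) show False by auto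
  qed
  have "?E \<subseteq> F"
  proof (rule ccontr)
    assume "\<not> ?E \<subseteq> F"
    then obtain u v where uv: "(u, v) \<in> parcs T" "{u, v} \<notin> F" by auto
    \<comment> \<open>The path from \<open>v\<close> back to \<open>u\<close> is taken inside
      \<open>F\<close>, so that it avoids the edge \<open>{u, v}\<close>.\<close>
    define G where "G = \<lparr>pverts = pverts T, parcs = {(x, y). {x, y} \<in> F}\<rparr>"
    have GT: "parcs G \<subseteq> parcs T"
    proof (rule subrelI)
      fix x y assume "(x, y) \<in> parcs G"
      with F(1) obtain u v where "{x, y} = {u, v}" "(u, v) \<in> parcs T" by (auto simp: G_def)
      then show "(x, y) \<in> parcs T" using sym by (auto simp: doubleton_eq_iff)
    qed
    interpret G: pair_wf_digraph G
    proof
      fix e assume "e \<in> parcs G"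
      with GT have "e \<in> parcs T" by auto
      then show "fst e \<in> pverts G" "snd e \<in> pverts G"
        using arc_fst_in_verts arc_snd_in_verts by (simp_all add: G_def)
    qed
    have "u \<in> pverts T" "v \<in> pverts T" using uv(1) in_arcsD1 in_arcsD2 by auto
    then have "v \<rightarrow>\<^sup>*\<^bsub>with_proj G\<^esub> u"
      using leaf_built_connected[OF F(2), of v u]
      by (simp add: G.reachable_conv S_eq) (simp add: G_def)
    then obtain p where p: "G.apath v p u" by (auto simp: G.reachable_apath)
    then have walk: "set p \<subseteq> parcs G" "pcas v p u" "distinct (pawalk_verts v p)"
      by (auto simp: G.apath_def G.awalk_def)
    \<comment> \<open>An empty path would make the arc a loop, and a single arc would put
      \<open>{u, v}\<close> into \<open>F\<close>. So the cycle is longer than the back-and-forth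
      walk that \<open>is_tree\<close> tolerates.\<close>
    have "2 \<le> length p"
    proof (rule ccontr)
      assume "\<not> 2 \<le> length p"
      then consider "p = []" | a where "p = [a]"
        by (cases p; cases "tl p") auto
      then show False
      proof cases
        case 1
        with walk(2) uv(1) pair_no_loops show False by fastforce
      next
        case (2 a)
        with walk(1,2) uv(2) show False by (cases a) (auto simp: G_def insert_commute)
      qed
    qed
    moreover have "cycle ((u, v) # p)"
      using uv(1) walk GT \<open>u \<in> pverts T\<close>
      by (auto simp: cycle_def awalk_def intro!: exI[of _ u])
    ultimately show False
      using assms by (auto simp: is_tree_def dest!: spec[of _ "(u, v) # p"])
  qed
  with F(1) have "F = ?E" by (rule subset_antisym)
  with F(2) S_eq show ?thesis by simp
qed

text \<open>With edges as indices and each edge as its own set of candidates, the bipartite graph is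
  the incidence graph of \<open>T\<close>, that is, its subdivision.\<close>

lemma bell_realizable_tree:
  assumes "is_tree T"
  shows "bell_realizable T"
proof -
  interpret pair_graph T using assms by (simp add: is_tree_def)
  define E where "E = {{u, v} | u v. (u, v) \<in> parcs T}"
  have lb: "leaf_built (pverts T) E" unfolding E_def by (rule is_tree_leaf_built[OF assms])
  have sub: "parcs T \<subseteq> pverts T \<times> pverts T" using in_arcsD1 in_arcsD2 by auto
  have mem: "{x, y} \<in> E \<longleftrightarrow> (x, y) \<in> parcs T" for x y
    using pair_sym_arcs by (auto simp: E_def symmetric_def sym_def doubleton_eq_iff)
  obtain f where f: "bij_betw f (pverts T) (sdrs E (\<lambda>e. e))"
    and adj: "\<forall>x\<in>pverts T. \<forall>y\<in>pverts T. {x, y} \<in> E \<longleftrightarrow> sdr_adj E (f x) (f y)"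
    using leaf_built_sdrs[OF lb] by (elim exE conjE) (rule that)
  show ?thesis
  proof (rule bell_realizableI_sdrs[OF leaf_built_finite(2)[OF lb] leaf_built_finite(1)[OF lb] _ _ sub f])
    show "pverts T \<noteq> {}"
      using assms by (auto simp: is_tree_def connected_def strongly_connected_def)
    show "e \<subseteq> pverts T" if "e \<in> E" for e using leaf_built_edge[OF lb that] by simp
    show "(x, y) \<in> parcs T \<longleftrightarrow> sdr_adj E (f x) (f y)" if "x \<in> pverts T" "y \<in> pverts T" for x y
      using bspec[OF bspec[OF adj that(1)] that(2)] mem[of x y] by simp
  qed
qed

section \<open>Cycles\<close>

lemma cycle_graph_arc_iff:
  assumes "3 \<le> n" "i < n" "j < n"
  shows "(i, j) \<in> parcs (cycle_graph n) \<longleftrightarrow>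
    j = Suc i \<or> i = Suc j \<or> (i = 0 \<and> Suc j = n) \<or> (j = 0 \<and> Suc i = n)"
  using assms by (auto simp: cycle_graph_def mod_Suc)

lemma pverts_cycle_graph [simp]: "pverts (cycle_graph n) = {..<n}"
  by (simp add: cycle_graph_def)

lemma parcs_cycle_graph_subset: "parcs (cycle_graph n) \<subseteq> {..<n} \<times> {..<n}"
  by (auto simp: cycle_graph_def)

text \<open>With a single index any two of the three choices differ in one coordinate, which gives a
  triangle.\<close>

lemma bell_realizable_cycle_3: "bell_realizable (cycle_graph 3)"
proof (rule bell_realizableI_sdrs[where B = "{()}" and A = "{..<3::nat}" and S = "\<lambda>_. {..<3}"
      and f = "\<lambda>i _. i"])
  show "bij_betw (\<lambda>i _. i) (pverts (cycle_graph 3)) (sdrs {()} (\<lambda>_. {..<3}))"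
  proof (rule bij_betw_byWitness[where f' = "\<lambda>f. f ()"])
  qed (auto simp: sdrs_def)
  show "(i, j) \<in> parcs (cycle_graph 3) \<longleftrightarrow> sdr_adj {()} (\<lambda>_. i) (\<lambda>_. j)"
    if "i \<in> pverts (cycle_graph 3)" "j \<in> pverts (cycle_graph 3)" for i j
    using that by (auto simp: cycle_graph_arc_iff sdr_adj_def fun_eq_iff)
qed (auto simp: parcs_cycle_graph_subset lessThan_empty_iff)

text \<open>Two independent binary choices form a square. The bipartite graph used here is two
  disjoint paths with two edges each, centred at \<open>True\<close> and
  \<open>False\<close>.\<close>

lemma bell_realizable_cycle_4: "bell_realizable (cycle_graph 4)"
proof -
  define S :: "bool \<Rightarrow> nat set" where "S b = (if b then {0, 1} else {2, 3})" for b
  \<comment> \<open>A Gray code: cyclically consecutive indices change exactly one of the two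
    choices.\<close>
  define f :: "nat \<Rightarrow> bool \<Rightarrow> nat" where
    "f i b = (if b then (if i = 0 \<or> i = 3 then 0 else 1) else (if i < 2 then 2 else 3))" for i b
  define g :: "(bool \<Rightarrow> nat) \<Rightarrow> nat" where
    "g h = (if h True = 0 then (if h False = 2 then 0 else 3) else (if h False = 2 then 1 else 2))" for h
  have four: "i = 0 \<or> i = 1 \<or> i = 2 \<or> i = 3" if "i < 4" for i :: nat
    using that by arith
  have UNIV: "PiE UNIV S = {h. h True \<in> {0, 1} \<and> h False \<in> {2, 3}}"
    by (auto simp: S_def PiE_def Pi_def all_bool_eq split: if_splits)
  have sdrs: "sdrs UNIV S = {h. h True \<in> {0, 1} \<and> h False \<in> {2, 3}}"
    unfolding sdrs_def UNIV by (auto simp: inj_def all_bool_eq)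
  have adj: "sdr_adj UNIV h k \<longleftrightarrow> (h True = k True) \<noteq> (h False = k False)" for h k :: "bool \<Rightarrow> nat"
    by (auto simp: sdr_adj_def Ball_def ex_bool_eq all_bool_eq fun_eq_iff)
  show ?thesis
  proof (rule bell_realizableI_sdrs[where B = UNIV and A = "{..<4}" and S = S and f = f])
    show "bij_betw f (pverts (cycle_graph 4)) (sdrs UNIV S)"
    proof (rule bij_betw_byWitness[where f' = g])
      show "\<forall>i\<in>pverts (cycle_graph 4). g (f i) = i"
        by (auto simp: f_def g_def dest!: four)
      show "\<forall>h\<in>sdrs UNIV S. f (g h) = h"
        by (auto simp: sdrs f_def g_def fun_eq_iff all_bool_eq)
      show "f ` pverts (cycle_graph 4) \<subseteq> sdrs UNIV S"
        by (auto simp: sdrs f_def split: if_splits)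
      show "g ` sdrs UNIV S \<subseteq> pverts (cycle_graph 4)"
        by (auto simp: g_def)
    qed
    show "(i, j) \<in> parcs (cycle_graph 4) \<longleftrightarrow> sdr_adj UNIV (f i) (f j)"
      if "i \<in> pverts (cycle_graph 4)" "j \<in> pverts (cycle_graph 4)" for i j
      using that four[of i] four[of j] by (auto simp: cycle_graph_arc_iff adj f_def)
  qed (auto simp: parcs_cycle_graph_subset lessThan_empty_iff S_def split: if_splits)
qed

section \<open>Even cycles of length at least 6\<close>

text \<open>
  With \<open>S i = {i, i + 1}\<close> alone the systems are the threshold functions \<open>thr t\<close>, which form a path.
  Adding \<open>r + 1\<close> to \<open>S 0\<close> and \<open>0\<close> to \<open>S r\<close> gives a second copy of this path, with the values
  \<open>0\<close> and \<open>r + 1\<close> swapped, and joins the ends of the two copies.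
\<close>

lemma bell_realizable_even_cycle:
  assumes r: "1 \<le> r"
  shows "bell_realizable (cycle_graph (2 * r + 4))"
proof -
  define n where "n = 2 * r + 4"
  define B :: "nat set" where "B = {..r}"
  define S where "S i = {i, Suc i} \<union> (if i = 0 then {Suc r} else {}) \<union> (if i = r then {0} else {})"
    for i :: nat
  \<comment> \<open>For \<open>t \<le> Suc r\<close> the last \<open>t\<close> indices are shifted
    up, so that the value \<open>r + 1 - t\<close> is missed.\<close>
  define thr where "thr t i = (if r < i + t then Suc i else i)" for t i :: nat
  \<comment> \<open>The values \<open>0\<close> and \<open>r + 1\<close> both lie in
    \<open>S 0\<close> and \<open>S r\<close> and in no other set, so exchanging them is a symmetry
    of the family.\<close>
  define swp where "swp x = (if x = 0 then Suc r else if x = Suc r then 0 else x)" for x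
  define F where "F s t = restrict (\<lambda>i. if s then swp (thr t i) else thr t i) B" for s t
  have F_app: "F s t i = (if s then swp (thr t i) else thr t i)" if "i \<le> r" for s t i
    using that by (simp add: F_def B_def)
  have swp_eq: "swp x = swp y \<longleftrightarrow> x = y" for x y by (auto simp: swp_def)
  have swp_swp: "swp (swp x) = x" for x by (auto simp: swp_def)

  have F_sdr: "F s t \<in> sdrs B S" if "t \<le> Suc r" for s t
  proof -
    have "inj_on (F s t) B"
      by (rule inj_onI) (auto simp: B_def F_app swp_eq thr_def split: if_splits)
    moreover have "(if s then swp (thr t i) else thr t i) \<in> S i" if "i \<le> r" for i
      using that r by (auto simp: S_def thr_def swp_def)
    then have "F s t \<in> PiE B S" unfolding F_def B_def by (intro restrict_PiE_iff[THEN iffD2]) auto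
    ultimately show ?thesis by (simp add: sdrs_def)
  qed

  have straight: "\<exists>t\<le>Suc r. \<forall>i\<le>r. h i = thr t i"
    if inj: "inj_on h {..r}" and h: "\<And>i. i \<le> r \<Longrightarrow> h i = i \<or> h i = Suc i" for h
  proof -
    \<comment> \<open>The first shifted index; the disjunct \<open>r < i\<close> yields
      \<open>Suc r\<close> if there is none. From \<open>j\<close> on, injectivity forces every
      index to be shifted.\<close>
    define j where "j = (LEAST i. r < i \<or> h i = Suc i)"
    have j: "r < j \<or> h j = Suc j" unfolding j_def by (rule LeastI[of _ "Suc r"]) simp
    have j_le: "j \<le> Suc r" unfolding j_def by (rule Least_le) simp
    have low: "h i = i" if "i < j" "i \<le> r" for i
      using not_less_Least[of i "\<lambda>i. r < i \<or> h i = Suc i"] that h[of i] by (auto simp: j_def)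
    have "i \<le> r \<longrightarrow> h i = Suc i" if "j \<le> i" for i
      using that
    proof (induction i rule: dec_induct)
      case base
      show ?case using j by auto
    next
      case (step i)
      show ?case
      proof
        assume "Suc i \<le> r"
        with step have "h i = Suc i" by simp
        with \<open>Suc i \<le> r\<close> have "h (Suc i) \<noteq> Suc i" using inj_onD[OF inj, of i "Suc i"] by auto
        with h[of "Suc i"] \<open>Suc i \<le> r\<close> show "h (Suc i) = Suc (Suc i)" by auto
      qed
    qed
    then have "h i = thr (Suc r - j) i" if "i \<le> r" for i
      using that low[of i] j_le by (auto simp: thr_def not_less)
    then show ?thesis by (intro exI[of _ "Suc r - j"]) auto
  qed

  have F_surj: "\<exists>s. \<exists>t\<le>Suc r. h = F s t" if h: "h \<in> sdrs B S" for h
  proof -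
    have inj: "inj_on h {..r}" and hS: "\<And>i. i \<le> r \<Longrightarrow> h i \<in> S i" and ext: "h = restrict h B"
      using h by (auto simp: sdrs_def B_def PiE_iff extensional_restrict)
    have h0: "h 0 = 0 \<or> h 0 = 1 \<or> h 0 = Suc r" and hr: "h r = r \<or> h r = Suc r \<or> h r = 0"
      using hS[of 0] hS[of r] r by (auto simp: S_def split: if_splits)
    have hi: "h i = i \<or> h i = Suc i" if "0 < i" "i < r" for i
      using hS[of i] that by (auto simp: S_def)
    have h0r: "h 0 \<noteq> h r" using inj_onD[OF inj, of 0 r] r by auto
    have "\<exists>s. \<forall>i\<le>r. (if s then swp (h i) else h i) = i \<or> (if s then swp (h i) else h i) = Suc i"
    \<comment> \<open>If one end uses its added value, injectivity keeps the other end from that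
      value, so after \<open>swp\<close> all choices lie in \<open>{i, i + 1}\<close>.\<close>
    proof (cases "h 0 = Suc r \<or> h r = 0")
      case True
      have "swp (h i) = i \<or> swp (h i) = Suc i" if "i \<le> r" for i
      proof -
        consider "i = 0" | "i = r" | "0 < i" "i < r" using \<open>i \<le> r\<close> by linarith
        then show ?thesis
          using h0 hr hi[of i] h0r True r by cases (auto simp: swp_def)
      qed
      then show ?thesis by (intro exI[of _ True]) simp
    next
      case False
      have "h i = i \<or> h i = Suc i" if "i \<le> r" for i
      proof -
        consider "i = 0" | "i = r" | "0 < i" "i < r" using \<open>i \<le> r\<close> by linarith
        then show ?thesis
          using h0 hr hi[of i] False by cases auto
      qed
      then show ?thesis by (intro exI[of _ False]) simp
    qed
    then obtain s where s: "\<And>i. i \<le> r \<Longrightarrow>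
        (if s then swp (h i) else h i) = i \<or> (if s then swp (h i) else h i) = Suc i" by blast
    have "inj_on (\<lambda>i. if s then swp (h i) else h i) {..r}"
      using inj by (auto simp: inj_on_def swp_eq)
    from straight[OF this s] obtain t where t: "t \<le> Suc r"
      "\<And>i. i \<le> r \<Longrightarrow> (if s then swp (h i) else h i) = thr t i" by blast
    have "h i = (if s then swp (thr t i) else thr t i)" if "i \<le> r" for i
      using t(2)[OF that] swp_swp[of "h i"] by (auto split: if_splits)
    then have "h = F s t" by (subst ext) (auto simp: F_def B_def restrict_def)
    with t(1) show ?thesis by blast
  qed

  have diff_same: "F s t i \<noteq> F s u i" if "i \<le> r" "i + t \<le> r" "r < i + u" for s t u i
    using that by (simp add: F_app swp_eq thr_def)
  \<comment> \<open>Across the copies, index 0 agrees only at threshold \<open>Suc r\<close> and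
    index \<open>r\<close> only at threshold 0. Otherwise both coordinates differ, which rules out
    adjacency.\<close>
  have diff_0: "F False t 0 = F True u 0 \<longleftrightarrow> t = Suc r \<and> u = Suc r" if "t \<le> Suc r" "u \<le> Suc r" for t u
    using that r by (auto simp: F_app swp_def thr_def)
  have diff_r: "F False t r = F True u r \<longleftrightarrow> t = 0 \<and> u = 0" if "t \<le> Suc r" "u \<le> Suc r" for t u
    using that r by (auto simp: F_app swp_def thr_def)

  \<comment> \<open>Passing from \<open>t\<close> to \<open>t + 1\<close> shifts exactly the index
    \<open>r - t\<close>.\<close>
  have step: "sdr_adj B (F s t) (F s (Suc t))" if "t \<le> r" for s t
    using that by (intro sdr_adjI[of "r - t"] diff_same) (auto simp: B_def F_app swp_eq thr_def)
  have far: "\<not> sdr_adj B (F s t) (F s u)" if "Suc t < u" "u \<le> Suc r" for s t u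
    using that by (intro not_sdr_adjI[of "r - t" _ "r - Suc t"] diff_same) (auto simp: B_def)
  have adj_same: "sdr_adj B (F s t) (F s u) \<longleftrightarrow> u = Suc t \<or> t = Suc u"
    if "t \<le> Suc r" "u \<le> Suc r" for s t u
  proof -
    consider "u = t" | "u = Suc t" | "t = Suc u" | "Suc t < u" | "Suc u < t" by linarith
    then show ?thesis
    proof cases
      case 1 then show ?thesis by (simp add: sdr_adj_def)
    next
      case 2 then show ?thesis using step that by simp
    next
      case 3 then show ?thesis using step[of u s] that sdr_adj_sym by fastforce
    next
      case 4 then show ?thesis using far that by simp
    next
      case 5 then show ?thesis using far[of u t s] that sdr_adj_sym[of B "F s t"] by simp
    qed
  qed
  have adj_swap: "sdr_adj B (F False t) (F True u) \<longleftrightarrow> t = u \<and> (t = 0 \<or> t = Suc r)"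
    if "t \<le> Suc r" "u \<le> Suc r" for t u
  proof -
    have *: "thr 0 c = c" "thr (Suc r) c = Suc c" if "c \<le> r" for c
      using that by (auto simp: thr_def)
    consider "t = 0" "u = 0" | "t = Suc r" "u = Suc r" | "\<not> (t = 0 \<and> u = 0)" "\<not> (t = Suc r \<and> u = Suc r)"
      by blast
    then show ?thesis
    proof cases
      case 1
      have "sdr_adj B (F False 0) (F True 0)"
        by (rule sdr_adjI[of 0]) (auto simp: B_def F_app * swp_def)
      with 1 show ?thesis by simp
    next
      case 2
      have "sdr_adj B (F False (Suc r)) (F True (Suc r))"
        by (rule sdr_adjI[of r]) (auto simp: B_def F_app * swp_def)
      with 2 show ?thesis by simp
    next
      case 3
      have "\<not> sdr_adj B (F False t) (F True u)"
        using diff_0[OF that] diff_r[OF that] r 3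
        by (intro not_sdr_adjI[of 0 _ r]) (auto simp: B_def)
      with 3 show ?thesis by auto
    qed
  qed

  have F_inj: "s = s' \<and> t = u" if "F s t = F s' u" "t \<le> Suc r" "u \<le> Suc r" for s s' t u
  proof
    have no: "F False t \<noteq> F True u" if "t \<le> Suc r" "u \<le> Suc r" for t u
      using diff_0[OF that] diff_r[OF that] by auto
    show "s = s'" using no[of t u] no[of u t] that by (cases s; cases s') auto
    with that(1) have "F s t = F s u" by simp
    then show "t = u"
    proof (cases t u rule: linorder_cases)
      case less
      then have "F s t (r - t) \<noteq> F s u (r - t)" using that by (intro diff_same) auto
      with \<open>F s t = F s u\<close> show ?thesis by simp
    next
      case greater
      then have "F s u (r - u) \<noteq> F s t (r - u)" using that by (intro diff_same) auto
      with \<open>F s t = F s u\<close> show ?thesis by simp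
    qed
  qed

  \<comment> \<open>Up the plain copy with \<open>t = j\<close>, then down the swapped one:
    \<open>j = r + 2\<close> starts it at \<open>t = r + 1\<close>, and the last index
    \<open>2 * r + 3\<close> reaches \<open>t = 0\<close>.\<close>
  define \<phi> where "\<phi> j = (if j < r + 2 then F False j else F True (2 * r + 3 - j))" for j
  have "bij_betw \<phi> {..<n} (sdrs B S)"
    unfolding bij_betw_def
  proof (intro conjI equalityI subsetI inj_onI)
    fix i j assume "i \<in> {..<n}" "j \<in> {..<n}" "\<phi> i = \<phi> j"
    then show "i = j" by (auto simp: \<phi>_def n_def split: if_splits dest!: F_inj)
  next
    fix h assume "h \<in> \<phi> ` {..<n}"
    then show "h \<in> sdrs B S" by (auto simp: \<phi>_def intro!: F_sdr)
  next
    fix h assume "h \<in> sdrs B S"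
    then obtain s t where st: "t \<le> Suc r" "h = F s t" using F_surj by blast
    show "h \<in> \<phi> ` {..<n}"
    proof (cases s)
      case True
      with st show ?thesis by (intro image_eqI[of _ _ "2 * r + 3 - t"]) (auto simp: \<phi>_def n_def)
    next
      case False
      with st show ?thesis by (intro image_eqI[of _ _ t]) (auto simp: \<phi>_def n_def)
    qed
  qed
  moreover have "(i, j) \<in> parcs (cycle_graph n) \<longleftrightarrow> sdr_adj B (\<phi> i) (\<phi> j)" if "i < n" "j < n" for i j
  proof -
    have arc: "(i, j) \<in> parcs (cycle_graph n) \<longleftrightarrow>
        j = Suc i \<or> i = Suc j \<or> (i = 0 \<and> Suc j = n) \<or> (j = 0 \<and> Suc i = n)"
      using that by (intro cycle_graph_arc_iff) (auto simp: n_def)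
    consider "i < r + 2" "j < r + 2" | "i < r + 2" "r + 2 \<le> j" | "r + 2 \<le> i" "j < r + 2"
      | "r + 2 \<le> i" "r + 2 \<le> j" by linarith
    then show ?thesis
    proof cases
      case 1
      then show ?thesis unfolding arc by (auto simp: \<phi>_def adj_same n_def)
    next
      case 2
      then have "sdr_adj B (\<phi> i) (\<phi> j) \<longleftrightarrow> i = 2 * r + 3 - j \<and> (i = 0 \<or> i = Suc r)"
        using adj_swap[of i "2 * r + 3 - j"] by (simp add: \<phi>_def)
      then show ?thesis unfolding arc using 2 that by (auto simp: n_def)
    next
      case 3
      then have "sdr_adj B (\<phi> i) (\<phi> j) \<longleftrightarrow> j = 2 * r + 3 - i \<and> (j = 0 \<or> j = Suc r)"
        using adj_swap[of j "2 * r + 3 - i"] by (simp add: \<phi>_def sdr_adj_sym[of B "F True _"])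
      then show ?thesis unfolding arc using 3 that by (auto simp: n_def)
    next
      case 4
      then have "sdr_adj B (\<phi> i) (\<phi> j) \<longleftrightarrow>
          2 * r + 3 - j = Suc (2 * r + 3 - i) \<or> 2 * r + 3 - i = Suc (2 * r + 3 - j)"
        using adj_same[of "2 * r + 3 - i" "2 * r + 3 - j" True] by (simp add: \<phi>_def)
      then show ?thesis unfolding arc using 4 that by (auto simp: n_def)
    qed
  qed
  moreover have "S b \<subseteq> {..Suc r}" if "b \<in> B" for b
    using that by (auto simp: S_def B_def split: if_splits)
  ultimately show ?thesis
    unfolding n_def[symmetric]
    by (intro bell_realizableI_sdrs[of B "{..Suc r}" S _ \<phi>]) (auto simp: parcs_cycle_graph_subset B_def)
qed

section \<open>Odd cycles of length at least 5\<close>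

text \<open>
  The matchings of size \<open>m\<close> of the cycle of length \<open>2 * m + 1\<close> are determined by the vertex \<open>h\<close> that
  they miss; \<open>C h j\<close> says that the edge from \<open>j\<close> to its successor is used. Sliding one edge moves the
  missed vertex by two, whence the relabelling \<open>d\<close> by doubling modulo the length.
\<close>

lemma bell_realizable_odd_cycle:
  assumes m: "2 \<le> m"
  shows "bell_realizable (cycle_graph (2 * m + 1))"
proof -
  define n where "n = 2 * m + 1"
  define V where "V = {..<n}"
  define nx where "nx i = (if Suc i = n then 0 else Suc i)" for i
  define pv where "pv i = (if i = 0 then n - 1 else i - 1)" for i
  define ed where "ed i = {i, nx i}" for i
  define E where "E = ed ` V"
  have n5: "5 \<le> n" using m by (simp add: n_def)
  have nxV: "nx i \<in> V" and pvV: "pv i \<in> V" if "i \<in> V" for i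
    using that n5 by (auto simp: nx_def pv_def V_def)
  have nx_pv: "nx (pv i) = i" and pv_nx: "pv (nx i) = i" if "i \<in> V" for i
    using that n5 by (auto simp: nx_def pv_def V_def)
  have nx_ne: "nx i \<noteq> i" "nx (nx i) \<noteq> i" if "i \<in> V" for i
    using that n5 by (auto simp: nx_def V_def split: if_splits)
  have nx_inj: "nx i = nx j \<longleftrightarrow> i = j" if "i \<in> V" "j \<in> V" for i j
    using that pv_nx by metis
  have in_ed: "v \<in> ed i \<longleftrightarrow> i = v \<or> i = pv v" if "v \<in> V" "i \<in> V" for v i
    using that nx_pv pv_nx by (auto simp: ed_def)
  have ed_inj: "ed i = ed j \<longleftrightarrow> i = j" if "i \<in> V" "j \<in> V" for i j
    using that nx_ne by (auto simp: ed_def doubleton_eq_iff)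
  have pair_in_E: "(v = nx u \<or> u = nx v) \<and> u \<in> V \<and> v \<in> V" if "{u, v} \<in> E" for u v
    using that nxV by (auto simp: E_def ed_def doubleton_eq_iff)
  interpret triangle_free_graph V E
  proof
    show "finite V" by (simp add: V_def)
    show "e \<subseteq> V \<and> card e = 2" if "e \<in> E" for e
      using that nxV nx_ne(1) by (fastforce simp: E_def ed_def)
    show False if "{u, v} \<in> E" "{v, w} \<in> E" "{u, w} \<in> E" for u v w
    proof -
      \<comment> \<open>This is where a cycle of length 3 would fail.\<close>
      have "nx (nx (nx i)) \<noteq> i" if "i \<in> V" for i
        using that n5 by (auto simp: nx_def V_def split: if_splits)
      then show False
        using that[THEN pair_in_E] nx_ne nx_inj by metis
    qed
  qed
  have card_V: "card V = 2 * m + 1" by (simp add: V_def n_def)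

  define C where "C h j = (if h \<le> j then odd (j - h) else even (h - j))" for h j :: nat
  define mt where "mt h = ed ` {j \<in> V. C h j}" for h
  have ed_mt: "ed j \<in> mt h \<longleftrightarrow> C h j" if "j \<in> V" for h j
    using that by (auto simp: mt_def ed_inj)
  have C_hole: "\<not> C h h" "\<not> C h (pv h)" if "h \<in> V" for h
    using that by (auto simp: C_def pv_def V_def n_def)
  have C_alt: "C h v \<longleftrightarrow> \<not> C h (pv v)" if "h \<in> V" "v \<in> V" "v \<noteq> h" for h v
    using that by (auto simp: C_def pv_def V_def n_def)
  have C_slide: "C h j \<longleftrightarrow> C (nx (nx h)) j" if "h \<in> V" "j \<in> V" "j \<noteq> h" "j \<noteq> nx h" for h j
    using that by (auto simp: C_def nx_def V_def n_def split: if_splits)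

  have Union_mt: "\<Union>(mt h) = V - {h}" if h: "h \<in> V" for h
  proof (intro equalityI subsetI)
    fix v assume "v \<in> \<Union>(mt h)"
    then obtain j where j: "j \<in> V" "C h j" "v \<in> ed j" by (auto simp: mt_def)
    then have "v \<in> V" using nxV by (auto simp: ed_def)
    with j in_ed[of v j] C_hole[OF h] show "v \<in> V - {h}" by auto
  next
    fix v assume v: "v \<in> V - {h}"
    then have "C h v \<or> C h (pv v)" using C_alt[OF h, of v] by auto
    then show "v \<in> \<Union>(mt h)" using v in_ed[of v v] in_ed[of v "pv v"] pvV by (auto simp: mt_def)
  qed
  have mt_matching0: "mt h \<in> matchings E 0" if h: "h \<in> V" for h
  proof -
    have "disjoint (mt h)"
    proof (rule disjointI)
      fix d e assume "d \<in> mt h" "e \<in> mt h" "d \<noteq> e"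
      then obtain i j where ij: "i \<in> V" "j \<in> V" "C h i" "C h j" "d = ed i" "e = ed j" "i \<noteq> j"
        by (auto simp: mt_def)
      show "d \<inter> e = {}"
      proof (rule ccontr)
        assume "d \<inter> e \<noteq> {}"
        then obtain v where v: "v \<in> ed i" "v \<in> ed j" using ij by auto
        then have "v \<in> V" using ij nxV by (auto simp: ed_def)
        with v ij in_ed have "C h v" "C h (pv v)" by metis+
        with C_alt[OF h \<open>v \<in> V\<close>] C_hole[OF h] show False by metis
      qed
    qed
    then show ?thesis by (auto simp: matchings_def mt_def E_def)
  qed
  have mt_matching: "mt h \<in> matchings E m" if h: "h \<in> V" for h
  proof -
    have "2 * card (mt h) = 2 * m"
      using card_Union_matching[OF mt_matching0[OF h]] Union_mt[OF h] h card_V finite_V by simp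
    then show ?thesis using mt_matching0[OF h] by (simp add: matchings_def)
  qed

  have mt_surj: "\<exists>h\<in>V. M = mt h" if M: "M \<in> matchings E m" for M
  proof -
    have ME: "M \<subseteq> E" and dis: "disjoint M" and "m \<le> card M" using M by (auto simp: matchings_def)
    have "2 * card M \<le> 2 * m + 1"
      using card_Union_matching[OF M] card_mono[OF finite_V Union_matching_subset[OF M]] card_V by simp
    with \<open>m \<le> card M\<close> have "card M = m" by simp
    then have "card (V - \<Union>M) = 1"
      using card_Union_matching[OF M] Union_matching_subset[OF M] card_V finite_V
      by (simp add: card_Diff_subset finite_subset)
    then obtain h where hole: "V - \<Union>M = {h}" by (auto simp: card_1_singleton_iff)
    then have h: "h \<in> V" "h \<notin> \<Union>M" by auto
    have hole_iff: "ed h \<notin> M" "ed (pv h) \<notin> M"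
      using h in_ed[of h h] in_ed[of h "pv h"] pvV by auto
    have alt: "ed v \<in> M \<longleftrightarrow> ed (pv v) \<notin> M" if v: "v \<in> V" "v \<noteq> h" for v
    proof
      assume "ed v \<in> M"
      show "ed (pv v) \<notin> M"
      proof
        assume "ed (pv v) \<in> M"
        moreover have "ed v \<noteq> ed (pv v)"
          using v pvV ed_inj nx_ne(1) nx_pv by metis
        ultimately have "ed v \<inter> ed (pv v) = {}" using disjointD[OF dis \<open>ed v \<in> M\<close>] by simp
        then show False using v pvV in_ed[of v v] in_ed[of v "pv v"] by auto
      qed
    next
      assume *: "ed (pv v) \<notin> M"
      from v hole obtain e where "e \<in> M" "v \<in> e" by auto
      moreover from this ME obtain i where "i \<in> V" "e = ed i" by (auto simp: E_def)
      ultimately show "ed v \<in> M" using * in_ed[of v i] v by auto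
    qed
    have up: "ed j \<in> M \<longleftrightarrow> C h j" if "h \<le> j" "j < n" for j
      using that
    proof (induction j rule: dec_induct)
      case base
      then show ?case using hole_iff C_hole[OF h(1)] by simp
    next
      case (step j)
      then have *: "Suc j \<in> V" "Suc j \<noteq> h" "pv (Suc j) = j" by (auto simp: V_def pv_def)
      show ?case using alt[OF *(1,2)] C_alt[OF h(1) *(1,2)] step by (simp add: *(3))
    qed
    have down: "ed j \<in> M \<longleftrightarrow> C h j" if "j \<le> h - 1" "0 < h" for j
      using that
    proof (induction j rule: inc_induct)
      case base
      then show ?case using hole_iff C_hole[OF h(1)] by (simp add: pv_def)
    next
      case (step j)
      then have *: "Suc j \<in> V" "Suc j \<noteq> h" "pv (Suc j) = j" using h(1) by (auto simp: V_def pv_def)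
      show ?case using alt[OF *(1,2)] C_alt[OF h(1) *(1,2)] step by (simp add: *(3))
    qed
    have "ed j \<in> M \<longleftrightarrow> C h j" if "j \<in> V" for j
      using up[of j] down[of j] that by (cases "h \<le> j") (auto simp: V_def)
    then have "M = mt h" using ME by (auto simp: mt_def E_def)
    with h show ?thesis by blast
  qed

  have mt_inj: "h = g" if "mt h = mt g" "h \<in> V" "g \<in> V" for h g
    using Union_mt[OF that(2)] Union_mt[OF that(3)] that by auto

  \<comment> \<open>The witness is the vertex between the two missed ones: its edge to
    \<open>nx (nx h)\<close> is replaced by its edge to \<open>h\<close>.\<close>
  have adj_nx: "matching_adj V (mt h) (mt (nx (nx h)))" if h: "h \<in> V" for h
  proof -
    have V: "nx h \<in> V" "nx (nx h) \<in> V" using nxV h by auto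
    have "mt h \<noteq> mt (nx (nx h))" using mt_inj[OF _ h V(2)] nx_ne(2)[OF h] by auto
    moreover have "{e \<in> mt g. nx h \<notin> e} = ed ` {j \<in> V. C g j \<and> j \<noteq> h \<and> j \<noteq> nx h}" for g
      using in_ed[OF V(1)] pv_nx[OF h] by (auto simp: mt_def)
    moreover have "{j \<in> V. C h j \<and> j \<noteq> h \<and> j \<noteq> nx h} =
        {j \<in> V. C (nx (nx h)) j \<and> j \<noteq> h \<and> j \<noteq> nx h}"
      using C_slide[OF h] by blast
    ultimately show ?thesis
      using V(1) unfolding matching_adj_def by (intro conjI bexI[of _ "nx h"]) simp_all
  qed
  have adj_sym: "matching_adj V M N \<longleftrightarrow> matching_adj V N M" for M N
    by (simp add: matching_adj_def eq_commute)
  have adj_only: "g = nx (nx h) \<or> h = nx (nx g)"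
    if adj: "matching_adj V (mt h) (mt g)" and h: "h \<in> V" and g: "g \<in> V" for h g
  proof -
    from adj obtain v where v: "v \<in> V" and eq: "{e \<in> mt h. v \<notin> e} = {e \<in> mt g. v \<notin> e}" and "h \<noteq> g"
      by (auto simp: matching_adj_def)
    have same: "C h j \<longleftrightarrow> C g j" if "j \<in> V" "j \<noteq> v" "j \<noteq> pv v" for j
    proof -
      have "v \<notin> ed j" using that in_ed[OF v] by blast
      then show ?thesis using eq ed_mt[OF that(1)] by blast
    qed
    \<comment> \<open>Deleting an uncovered vertex loses no edge, so \<open>mt a\<close> would lie
      inside \<open>mt b\<close>, although \<open>mt a\<close> covers \<open>b\<close>.\<close>
    have not_hole: "v \<noteq> a" if "{e \<in> mt a. v \<notin> e} = {e \<in> mt b. v \<notin> e}" "a \<in> V" "b \<in> V" "a \<noteq> b" for a b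
    proof
      assume "v = a"
      have "v \<notin> \<Union>(mt a)" using Union_mt[OF that(2)] \<open>v = a\<close> by simp
      then have "mt a \<subseteq> mt b" using that(1) by blast
      then have "\<Union>(mt a) \<subseteq> \<Union>(mt b)" by blast
      then show False using Union_mt[OF that(2)] Union_mt[OF that(3)] that(3,4) by auto
    qed
    have vh: "v \<noteq> h" by (rule not_hole[OF eq h g \<open>h \<noteq> g\<close>])
    have vg: "v \<noteq> g" using \<open>h \<noteq> g\<close> by (intro not_hole[OF eq[symmetric] g h]) auto
    \<comment> \<open>Both matchings cover \<open>v\<close>, through different edges; the far end of each of the two edges is
      the vertex that the other matching misses.\<close>
    have slide: "b = nx v \<and> a = pv v"
      if ab: "a \<in> V" "b \<in> V" "v \<noteq> a" "v \<noteq> b" "C a v" "\<not> C b v"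
        and same': "\<And>j. j \<in> V \<Longrightarrow> j \<noteq> v \<Longrightarrow> j \<noteq> pv v \<Longrightarrow> C a j \<longleftrightarrow> C b j" for a b
    proof
      have a_pv: "\<not> C a (pv v)" using C_alt[OF ab(1) v] ab by auto
      have b_pv: "C b (pv v)" using C_alt[OF ab(2) v] ab by auto
      have nv: "nx v \<in> V" "pv (nx v) = v" "nx v \<noteq> v" using nxV pv_nx nx_ne(1) v by auto
      have "nx v \<noteq> pv v" using nx_ne(2)[OF pvV[OF v]] nx_pv[OF v] by metis
      show "b = nx v"
      proof (rule ccontr)
        assume "b \<noteq> nx v"
        then have "C b (nx v)" using C_alt[OF ab(2) nv(1)] ab(6) nv(2) by auto
        then have "C a (nx v)" using same'[OF nv(1) nv(3) \<open>nx v \<noteq> pv v\<close>] by simp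
        then show False using C_alt[OF ab(1) nv(1)] C_hole(1)[OF ab(1)] ab(5) nv(2) by metis
      qed
      have pv: "pv v \<in> V" "pv (pv v) \<in> V" using pvV v by auto
      have ppv: "pv (pv v) \<noteq> v" "pv (pv v) \<noteq> pv v"
        using nx_ne pv nx_pv v by metis+
      show "a = pv v"
      proof (rule ccontr)
        assume "a \<noteq> pv v"
        then have "C a (pv (pv v))" using C_alt[OF ab(1) pv(1)] a_pv by auto
        then have "C b (pv (pv v))" using same'[OF pv(2) ppv] by simp
        then show False using C_alt[OF ab(2) pv(1)] C_hole(1)[OF ab(2)] b_pv by metis
      qed
    qed
    \<comment> \<open>Otherwise both matchings would treat the two edges at \<open>v\<close> alike,
      and they already agree on all other edges.\<close>
    have "C h v \<noteq> C g v"
    proof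
      assume *: "C h v = C g v"
      then have "C h (pv v) = C g (pv v)" using C_alt[OF h v vh] C_alt[OF g v vg] by auto
      with * same have "C h j = C g j" if "j \<in> V" for j using that by metis
      then have "mt h = mt g" by (auto simp: mt_def)
      with mt_inj h g \<open>h \<noteq> g\<close> show False by blast
    qed
    then consider "C h v" "\<not> C g v" | "C g v" "\<not> C h v" by blast
    then show ?thesis
    proof cases
      case 1
      from slide[OF h g vh vg this same] nx_pv[OF v] show ?thesis by auto
    next
      case 2
      from slide[OF g h vg vh this] same nx_pv[OF v] show ?thesis by auto
    qed
  qed
  have adj_iff: "matching_adj V (mt h) (mt g) \<longleftrightarrow> g = nx (nx h) \<or> h = nx (nx g)"
    if "h \<in> V" "g \<in> V" for h g
    using adj_only adj_nx adj_sym that by metis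

  \<comment> \<open>Doubling modulo \<open>n\<close> is injective because \<open>n\<close> is odd;
    beyond \<open>m\<close> the double exceeds \<open>n\<close>.\<close>
  define d where "d i = (if i \<le> m then 2 * i else 2 * i - n)" for i
  have dV: "d i \<in> V" if "i \<in> V" for i using that by (auto simp: d_def V_def n_def)
  have d_inj: "inj_on d V"
  proof (rule inj_onI)
    fix i j assume "i \<in> V" "j \<in> V" "d i = d j"
    then show "i = j" unfolding d_def V_def n_def by (auto split: if_splits) presburger+
  qed
  have d_nx: "d (nx i) = nx (nx (d i))" if "i \<in> V" for i
    using that m by (auto simp: d_def nx_def V_def n_def)
  have d_bij: "bij_betw d V V"
    using d_inj dV endo_inj_surj[OF finite_V _ d_inj] by (auto simp: bij_betw_def)
  have "bij_betw mt V (matchings E m)"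
    unfolding bij_betw_def
  proof (intro conjI equalityI subsetI inj_onI)
    show "M \<in> mt ` V" if "M \<in> matchings E m" for M using mt_surj[OF that] by blast
  qed (use mt_inj mt_matching in auto)
  from bij_betw_trans[OF d_bij this] have bij: "bij_betw (mt \<circ> d) V (matchings E m)" .
  have "(i, j) \<in> parcs (cycle_graph n) \<longleftrightarrow> matching_adj V ((mt \<circ> d) i) ((mt \<circ> d) j)"
    if i: "i \<in> V" and j: "j \<in> V" for i j
  proof -
    have "matching_adj V (mt (d i)) (mt (d j)) \<longleftrightarrow> d j = d (nx i) \<or> d i = d (nx j)"
      using adj_iff[OF dV[OF i] dV[OF j]] by (simp add: d_nx i j)
    also have "\<dots> \<longleftrightarrow> j = nx i \<or> i = nx j"
      using d_inj i j nxV by (simp add: inj_on_eq_iff)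
    also have "\<dots> \<longleftrightarrow> (i, j) \<in> parcs (cycle_graph n)"
      using cycle_graph_arc_iff[of n i j] i j n5 by (auto simp: nx_def V_def)
    finally show ?thesis by simp
  qed
  then show ?thesis
    unfolding n_def[symmetric] using bij card_V parcs_cycle_graph_subset
    by (intro bell_realizableI_matchings[OF triangle_free_graph_axioms, of m _ "mt \<circ> d"])
       (auto simp: V_def)
qed

theorem theorem4p9:
  shows "(\<forall>T :: 'a pair_pre_digraph. is_tree T \<longrightarrow> bell_realizable T) \<and>
         (\<forall>n\<ge>3. bell_realizable (cycle_graph n))"
proof (intro conjI allI impI)
  fix n :: nat assume n: "3 \<le> n"
  consider "n = 3" | "n = 4" | m where "n = 2 * m + 1" "2 \<le> m" | r where "n = 2 * r + 4" "1 \<le> r"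
  proof (cases "even n")
    case True
    then obtain q where "n = 2 * q" by blast
    then show ?thesis using n that(2) that(4)[of "q - 2"] by (cases "q = 2") auto
  next
    case False
    then obtain q where "n = 2 * q + 1" by (blast elim: oddE)
    then show ?thesis using n that(1) that(3)[of q] by (cases "q = 1") auto
  qed
  then show "bell_realizable (cycle_graph n)"
    using bell_realizable_cycle_3 bell_realizable_cycle_4 bell_realizable_odd_cycle
      bell_realizable_even_cycle by cases auto
qed (rule bell_realizable_tree)

end
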